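(* Let $\{X_n\}_{n\in\mathbb{N}}$ be a sequence of Banach spaces and let $\mathcal{U}$ be a free ultrafilter on $\mathbb{N}$. For any uniformly bounded sequence of operators $T_n\in\mathcal{L}(X_n)$ (that is, $\sup_n\|T_n\|<\infty$), $$v\big((T_n)_{\mathcal{U}}\big)=\lim_{\mathcal{U}} v(T_n),$$ where $(T_n)_{\mathcal{U}}$ is the ultraproduct operator on $\prod_{\mathcal{U}}X_n$.
   Context: Banach spaces are over $\mathbb{K}$ ($\mathbb{R}$ or $\mathbb{C}$). For a Banach space $E$, $\mathcal{L}(E)$ denotes the bounded linear operators on $E$, $S_E$ the unit sphere, $E^*$ the dual space. Numerical radius: for $T\in\mathcal{L}(E)$, $$v(T)=\sup\{|x^*(Tx)| : x\in S_E,\ x^*\in S_{E^*},\ x^*(x)=1\}.$$ Ultraproduct: for Banach spaces $\{X_n\}_{n\in\mathbb{N}}$ and a free (non-principal) ultrafilter $\mathcal{U}$ on $\mathbb{N}$, $\prod_{\mathcal{U}}X_n=\ell_\infty(\{X_n\})/c_{0,\mathcal{U}}(\{X_n\})$, where $\ell_\infty(\{X_n\})$ is the space of bounded sequences $(x_n)$ with $x_n\in X_n$ (sup norm) and $c_{0,\mathcal{U}}(\{X_n\})=\{(x_n)\in\ell_\infty(\{X_n\}):\lim_{\mathcal{U}}\|x_n\|=0\}$. The class of $(x_n)$ is denoted $(x_n)_{\mathcal{U}}$; the quotient norm satisfies $\|(x_n)_{\mathcal{U}}\|=\lim_{\mathcal{U}}\|x_n\|$. Here $\lim_{\mathcal{U}}$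 denotes the limit of a bounded scalar sequence along $\mathcal{U}$. Ultraproduct operator: for $T_n\in\mathcal{L}(X_n)$ with $\sup_n\|T_n\|<\infty$, $(T_n)_{\mathcal{U}}\in\mathcal{L}(\prod_{\mathcal{U}}X_n)$ is defined by $(T_n)_{\mathcal{U}}((x_n)_{\mathcal{U}})=(T_nx_n)_{\mathcal{U}}$. *)

theory Defs
  imports "HOL-Algebra.Algebraic_Closure_Type" "HOL-Analysis.Analysis"
begin

subsection \<open>The scalar field\<close>

text \<open>
  The scalar field is the field of reals or the field of complex numbers: the class axiom says
  that the field is either \<open>\<real>1\<close> or \<open>\<real>1 + \<real>i\<close> with \<open>i\<^sup>2 = -1\<close>. Multiplicativity of the norm then
  forces it to be the usual absolute value.
\<close>

class real_or_complex = real_normed_field +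
  assumes real_or_complex:
    "(\<forall>x. \<exists>r. x = r *\<^sub>R 1) \<or> (\<exists>i. i * i = - 1 \<and> (\<forall>x. \<exists>a b. x = a *\<^sub>R 1 + b *\<^sub>R i))"

instance real :: real_or_complex
  by standard simp

instance complex :: real_or_complex
proof
  have "\<forall>x. \<exists>a b. x = a *\<^sub>R 1 + b *\<^sub>R \<i>"
    by (metis complex_eq mult.commute scaleR_conv_of_real mult.right_neutral)
  then show "(\<forall>x::complex. \<exists>r. x = r *\<^sub>R 1) \<or>
      (\<exists>i::complex. i * i = - 1 \<and> (\<forall>x. \<exists>a b. x = a *\<^sub>R 1 + b *\<^sub>R i))"
    using i_squared by blast
qed


subsection \<open>Banach spaces\<close>

text \<open>
  A sequence of Banach spaces has to be a family of structures with explicit carriers, each member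
  with its own operations. The fields \<open>mult\<close> and \<open>one\<close>, inherited by modules from rings, play
  no role in a vector space.
\<close>

record ('k, 'v) normed_space = "('k, 'v) module" +
  nrm :: "'v \<Rightarrow> real"

definition vdist :: "('k, 'v) normed_space \<Rightarrow> 'v \<Rightarrow> 'v \<Rightarrow> real" where
  \<comment> \<open>set to 0 outside the carrier, because \<open>Metric_space\<close> asks for a symmetric
      nonnegative function on the whole type\<close>
  "vdist E x y = (if x \<in> carrier E \<and> y \<in> carrier E then nrm E (x \<ominus>\<^bsub>E\<^esub> y) else 0)"

locale banach_space =
  fixes E :: "('k::real_or_complex, 'v) normed_space"
  assumes vector_space: "Module.module (ring_of_type_algebra :: 'k ring) E"
    and nrm_eq_0: "x \<in> carrier E \<Longrightarrow> nrm E x = 0 \<Longrightarrow> x = \<zero>\<^bsub>E\<^esub>"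
    and nrm_triangle: "x \<in> carrier E \<Longrightarrow> y \<in> carrier E \<Longrightarrow> nrm E (x \<oplus>\<^bsub>E\<^esub> y) \<le> nrm E x + nrm E y"
    and nrm_smult: "x \<in> carrier E \<Longrightarrow> nrm E (a \<odot>\<^bsub>E\<^esub> x) = norm a * nrm E x"
    and complete: "Metric_space.mcomplete (carrier E) (vdist E)"

definition scalar_space :: "('k::real_or_complex, 'k) normed_space" where
  "scalar_space = \<lparr>carrier = UNIV, monoid.mult = (*), one = 1, zero = 0, add = (+),
     module.smult = (*), nrm = norm\<rparr>"


subsection \<open>Bounded operators and the numerical radius\<close>

text \<open>
  Operators are functions on the whole type of which only the values on the carrier matter.
\<close>

definition bounded_ops ::
  "('k::real_or_complex, 'v) normed_space \<Rightarrow> ('k, 'w) normed_space \<Rightarrow> ('v \<Rightarrow> 'w) set" where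
  "bounded_ops E F = {T. T \<in> carrier E \<rightarrow> carrier F \<and>
     (\<forall>x\<in>carrier E. \<forall>y\<in>carrier E. T (x \<oplus>\<^bsub>E\<^esub> y) = T x \<oplus>\<^bsub>F\<^esub> T y) \<and>
     (\<forall>a. \<forall>x\<in>carrier E. T (a \<odot>\<^bsub>E\<^esub> x) = a \<odot>\<^bsub>F\<^esub> T x) \<and>
     (\<exists>C. \<forall>x\<in>carrier E. nrm F (T x) \<le> C * nrm E x)}"

definition opnorm ::
  "('k, 'v) normed_space \<Rightarrow> ('k, 'w) normed_space \<Rightarrow> ('v \<Rightarrow> 'w) \<Rightarrow> real" where
  "opnorm E F T = (SUP x\<in>{x \<in> carrier E. nrm E x \<le> 1}. nrm F (T x))"

definition unit_sphere :: "('k, 'v) normed_space \<Rightarrow> 'v set" where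
  "unit_sphere E = {x \<in> carrier E. nrm E x = 1}"

definition dual_unit_sphere :: "('k::real_or_complex, 'v) normed_space \<Rightarrow> ('v \<Rightarrow> 'k) set" where
  "dual_unit_sphere E = {f \<in> bounded_ops E scalar_space. opnorm E scalar_space f = 1}"

text \<open>
  Inserting \<open>0\<close> does not change the supremum of a nonempty set of nonnegative reals; it only makes
  the supremum over the empty set, which occurs exactly for the zero space, equal to \<open>0\<close>.
\<close>

definition numerical_radius :: "('k::real_or_complex, 'v) normed_space \<Rightarrow> ('v \<Rightarrow> 'v) \<Rightarrow> real" where
  "numerical_radius E T =
     Sup (insert 0 {norm (f (T x)) | x f. x \<in> unit_sphere E \<and> f \<in> dual_unit_sphere E \<and> f x = 1})"


subsection \<open>Ultraproducts\<close>

definition free_ultrafilter :: "'i filter \<Rightarrow> bool" where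
  "free_ultrafilter U \<longleftrightarrow> U \<noteq> bot \<and>
     (\<forall>P. eventually P U \<or> eventually (\<lambda>i. \<not> P i) U) \<and>
     (\<forall>i. U \<noteq> principal {i})"

definition linf_space ::
  "(nat \<Rightarrow> ('k::real_or_complex, 'v) normed_space) \<Rightarrow> ('k, nat \<Rightarrow> 'v) normed_space" where
  "linf_space E = \<lparr>
     carrier = {x. (\<forall>n. x n \<in> carrier (E n)) \<and> bdd_above (range (\<lambda>n. nrm (E n) (x n)))},
     monoid.mult = undefined, one = undefined,
     zero = (\<lambda>n. \<zero>\<^bsub>E n\<^esub>),
     add = (\<lambda>x y n. x n \<oplus>\<^bsub>E n\<^esub> y n),
     module.smult = (\<lambda>a x n. a \<odot>\<^bsub>E n\<^esub> x n),
     nrm = (\<lambda>x. SUP n. nrm (E n) (x n))\<rparr>"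

definition c0_space ::
  "nat filter \<Rightarrow> (nat \<Rightarrow> ('k::real_or_complex, 'v) normed_space) \<Rightarrow> (nat \<Rightarrow> 'v) set" where
  "c0_space U E = {x \<in> carrier (linf_space E). ((\<lambda>n. nrm (E n) (x n)) \<longlongrightarrow> 0) U}"

text \<open>
  The quotient of \<open>E\<close> by a closed subspace \<open>N\<close> with the quotient norm. The set of which \<open>the_elem\<close>
  is taken is a singleton, since the coset of \<open>a \<odot> x\<close> depends only on that of \<open>x\<close>.
\<close>

definition quotient_space ::
  "('k, 'v) normed_space \<Rightarrow> 'v set \<Rightarrow> ('k, 'v set) normed_space" where
  "quotient_space E N = \<lparr>
     carrier = a_rcosets\<^bsub>E\<^esub> N,
     monoid.mult = undefined, one = undefined,
     zero = N,
     add = (\<lambda>A B. A <+>\<^bsub>E\<^esub> B),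
     module.smult = (\<lambda>a A. the_elem ((\<lambda>x. N +>\<^bsub>E\<^esub> (a \<odot>\<^bsub>E\<^esub> x)) ` A)),
     nrm = (\<lambda>A. INF x\<in>A. nrm E x)\<rparr>"

definition ultraproduct ::
  "nat filter \<Rightarrow> (nat \<Rightarrow> ('k::real_or_complex, 'v) normed_space) \<Rightarrow>
   ('k, (nat \<Rightarrow> 'v) set) normed_space" where
  "ultraproduct U E = quotient_space (linf_space E) (c0_space U E)"

definition ultraclass ::
  "nat filter \<Rightarrow> (nat \<Rightarrow> ('k::real_or_complex, 'v) normed_space) \<Rightarrow> (nat \<Rightarrow> 'v) \<Rightarrow>
   (nat \<Rightarrow> 'v) set" where
  "ultraclass U E x = c0_space U E +>\<^bsub>linf_space E\<^esub> x"

text \<open>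
  For a uniformly bounded sequence of operators the class of \<open>T\<^sub>n x\<^sub>n\<close> is the same for all
  representatives \<open>x\<close> of a given element of the ultraproduct.
\<close>

definition ultraproduct_op ::
  "nat filter \<Rightarrow> (nat \<Rightarrow> ('k::real_or_complex, 'v) normed_space) \<Rightarrow> (nat \<Rightarrow> 'v \<Rightarrow> 'v) \<Rightarrow>
   (nat \<Rightarrow> 'v) set \<Rightarrow> (nat \<Rightarrow> 'v) set" where
  "ultraproduct_op U E T A = the_elem ((\<lambda>x. ultraclass U E (\<lambda>n. T n (x n))) ` A)"

end

theory Submission
  imports Defs
begin

text \<open>
  Lower bound: pairs \<open>(x\<^sub>n, f\<^sub>n)\<close> that almost attain \<open>v(T\<^sub>n)\<close> have an ultraproduct that is an admissible
  pair for \<open>(T\<^sub>n)\<^sub>U\<close>.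

  Upper bound: the dual of an ultraproduct is in general larger than the ultraproduct of the duals, so
  functionals \<open>F\<close> on the ultraproduct have to be eliminated. If \<open>F X = 1\<close>, \<open>|\<theta>| = 1\<close> and
  \<open>\<theta> F(T X) = r \<ge> 0\<close>, then \<open>1 + \<alpha> r = F((I + \<alpha> \<theta> T) X)\<close> is at most \<open>lim \<parallel>(I + \<alpha> \<theta> T\<^sub>n) x\<^sub>n\<parallel>\<close>. Support
  functionals in the spaces \<open>E\<^sub>n\<close> give \<open>\<parallel>(I - \<alpha> \<theta> T\<^sub>n) y\<parallel> \<ge> (1 - \<alpha> v(T\<^sub>n)) \<parallel>y\<parallel>\<close>; with
  \<open>y = (I + \<alpha> \<theta> T\<^sub>n) x\<^sub>n\<close> this yields \<open>(1 - \<alpha> L) (1 + \<alpha> r) \<le> 1 + \<alpha>\<^sup>2 M\<^sup>2\<close>, where \<open>L = lim v(T\<^sub>n)\<close> and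
  \<open>M\<close> bounds the norms of the \<open>T\<^sub>n\<close>. Letting \<open>\<alpha> \<rightarrow> 0\<close> gives \<open>r \<le> L\<close>.
\<close>


subsection \<open>Elementary facts on normed spaces\<close>

context banach_space
begin

sublocale abelian_group E
  using vector_space by (simp add: Module.module_def)

lemma smult_closed [simp, intro]: "x \<in> carrier E \<Longrightarrow> a \<odot>\<^bsub>E\<^esub> x \<in> carrier E"
  using module.smult_closed[OF vector_space] by (simp add: ring_of_type_algebra_def)

lemma smult_l_distr:
  "x \<in> carrier E \<Longrightarrow> (a + b) \<odot>\<^bsub>E\<^esub> x = a \<odot>\<^bsub>E\<^esub> x \<oplus>\<^bsub>E\<^esub> b \<odot>\<^bsub>E\<^esub> x"
  using module.smult_l_distr[OF vector_space] by (simp add: ring_of_type_algebra_def)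

lemma smult_r_distr:
  "x \<in> carrier E \<Longrightarrow> y \<in> carrier E \<Longrightarrow> a \<odot>\<^bsub>E\<^esub> (x \<oplus>\<^bsub>E\<^esub> y) = a \<odot>\<^bsub>E\<^esub> x \<oplus>\<^bsub>E\<^esub> a \<odot>\<^bsub>E\<^esub> y"
  using module.smult_r_distr[OF vector_space] by (simp add: ring_of_type_algebra_def)

lemma smult_smult: "x \<in> carrier E \<Longrightarrow> a \<odot>\<^bsub>E\<^esub> (b \<odot>\<^bsub>E\<^esub> x) = (a * b) \<odot>\<^bsub>E\<^esub> x"
  using module.smult_assoc1[OF vector_space] by (simp add: ring_of_type_algebra_def)

lemma smult_1 [simp]: "x \<in> carrier E \<Longrightarrow> 1 \<odot>\<^bsub>E\<^esub> x = x"
  using module.smult_one[OF vector_space] by (simp add: ring_of_type_algebra_def)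

lemma smult_0 [simp]: "x \<in> carrier E \<Longrightarrow> 0 \<odot>\<^bsub>E\<^esub> x = \<zero>\<^bsub>E\<^esub>"
  using module.smult_l_null[OF vector_space] by (simp add: ring_of_type_algebra_def)

lemma smult_zero [simp]: "a \<odot>\<^bsub>E\<^esub> \<zero>\<^bsub>E\<^esub> = \<zero>\<^bsub>E\<^esub>"
  using module.smult_r_null[OF vector_space] by (simp add: ring_of_type_algebra_def)

lemma smult_minus_1: "x \<in> carrier E \<Longrightarrow> (- 1) \<odot>\<^bsub>E\<^esub> x = \<ominus>\<^bsub>E\<^esub> x"
  by (rule minus_equality[symmetric]) (use smult_l_distr[of x "- 1" 1] in auto)

lemma nrm_zero [simp]: "nrm E \<zero>\<^bsub>E\<^esub> = 0"
  using nrm_smult[of "\<zero>\<^bsub>E\<^esub>" 0] by simp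

lemma nrm_uminus [simp]: "x \<in> carrier E \<Longrightarrow> nrm E (\<ominus>\<^bsub>E\<^esub> x) = nrm E x"
  using nrm_smult[of x "- 1"] by (simp add: smult_minus_1)

lemma nrm_nonneg [simp]: "x \<in> carrier E \<Longrightarrow> 0 \<le> nrm E x"
  using nrm_triangle[of x "\<ominus>\<^bsub>E\<^esub> x"] by (simp add: r_neg)

lemma nrm_triangle_rev:
  assumes "x \<in> carrier E" "y \<in> carrier E"
  shows "nrm E x - nrm E y \<le> nrm E (x \<oplus>\<^bsub>E\<^esub> y)"
proof -
  have "x = (x \<oplus>\<^bsub>E\<^esub> y) \<oplus>\<^bsub>E\<^esub> (\<ominus>\<^bsub>E\<^esub> y)"
    using assms by (simp add: a_assoc r_neg)
  then show ?thesis
    using assms nrm_triangle[of "x \<oplus>\<^bsub>E\<^esub> y" "\<ominus>\<^bsub>E\<^esub> y"] by simp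
qed

end


subsection \<open>The Hahn--Banach theorem\<close>

text \<open>Scalars act through \<open>of_real\<close>, so a complex space is treated as a real one.
  Functionals live on the whole carrier: Hahn-Banach is reached by minimising sublinear functionals,
  not by extending linear ones from subspaces.\<close>

definition real_sublinear :: "('k::real_normed_field, 'v) normed_space \<Rightarrow> ('v \<Rightarrow> real) \<Rightarrow> bool" where
  "real_sublinear E q \<longleftrightarrow>
     (\<forall>x\<in>carrier E. \<forall>y\<in>carrier E. q (x \<oplus>\<^bsub>E\<^esub> y) \<le> q x + q y) \<and>
     (\<forall>t\<ge>0. \<forall>x\<in>carrier E. q (of_real t \<odot>\<^bsub>E\<^esub> x) = t * q x)"

section \<open>Calculus of real sublinear functionals, and minimal ones\<close>

context banach_space
begin

text \<open>One inequality for positive scalars suffices for homogeneity: applied to the scalar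
  \<open>1/t\<close> and the vector \<open>t x\<close> it gives the reverse inequality.\<close>

lemma real_sublinearI:
  assumes add: "\<And>x y. x \<in> carrier E \<Longrightarrow> y \<in> carrier E \<Longrightarrow> q (x \<oplus>\<^bsub>E\<^esub> y) \<le> q x + q y"
    and zero: "q \<zero>\<^bsub>E\<^esub> = 0"
    and smult: "\<And>t x. t > 0 \<Longrightarrow> x \<in> carrier E \<Longrightarrow> q (of_real t \<odot>\<^bsub>E\<^esub> x) \<le> t * q x"
  shows "real_sublinear E q"
proof -
  have "q (of_real t \<odot>\<^bsub>E\<^esub> x) = t * q x" if "t \<ge> 0" "x \<in> carrier E" for t x
  proof (cases "t = 0")
    case False
    then have "t > 0" using that by simp
    have "q x = q (of_real (1/t) \<odot>\<^bsub>E\<^esub> (of_real t \<odot>\<^bsub>E\<^esub> x))"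
      using that False by (simp add: smult_smult)
    also have "\<dots> \<le> 1/t * q (of_real t \<odot>\<^bsub>E\<^esub> x)"
      using \<open>t > 0\<close> that by (intro smult) auto
    finally have "t * q x \<le> q (of_real t \<odot>\<^bsub>E\<^esub> x)"
      using \<open>t > 0\<close> by (simp add: field_simps)
    with smult[OF \<open>t > 0\<close> that(2)] show ?thesis by simp
  qed (use that zero in auto)
  with add show ?thesis by (auto simp: real_sublinear_def)
qed

lemma real_sublinear_add:
  "real_sublinear E q \<Longrightarrow> x \<in> carrier E \<Longrightarrow> y \<in> carrier E \<Longrightarrow> q (x \<oplus>\<^bsub>E\<^esub> y) \<le> q x + q y"
  by (simp add: real_sublinear_def)

lemma real_sublinear_smult:
  "real_sublinear E q \<Longrightarrow> t \<ge> 0 \<Longrightarrow> x \<in> carrier E \<Longrightarrow> q (of_real t \<odot>\<^bsub>E\<^esub> x) = t * q x"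
  by (simp add: real_sublinear_def)

lemma real_sublinear_nrm: "real_sublinear E (nrm E)"
  by (auto simp: real_sublinear_def nrm_triangle nrm_smult)

lemma real_sublinear_zero:
  assumes "real_sublinear E q"
  shows "q \<zero>\<^bsub>E\<^esub> = 0"
proof -
  have "q (of_real 0 \<odot>\<^bsub>E\<^esub> \<zero>\<^bsub>E\<^esub>) = 0 * q \<zero>\<^bsub>E\<^esub>"
    using assms zero_closed unfolding real_sublinear_def by blast
  then show ?thesis by simp
qed

lemma real_sublinear_uminus:
  assumes "real_sublinear E q" "x \<in> carrier E"
  shows "- q (\<ominus>\<^bsub>E\<^esub> x) \<le> q x"
proof -
  have "q (x \<oplus>\<^bsub>E\<^esub> (\<ominus>\<^bsub>E\<^esub> x)) \<le> q x + q (\<ominus>\<^bsub>E\<^esub> x)"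
    using assms unfolding real_sublinear_def by blast
  then show ?thesis
    using assms by (simp add: r_neg real_sublinear_zero)
qed

text \<open>For sublinear \<open>q\<close> the term \<open>t = 1\<close> makes the value at
  \<open>- y\<close> at most \<open>- q y\<close>. A linear functional below the tilt therefore
  takes a value of at least \<open>q y\<close> at \<open>y\<close>.\<close>

definition tilt :: "('v \<Rightarrow> real) \<Rightarrow> 'v \<Rightarrow> 'v \<Rightarrow> real" where
  "tilt q y x = (INF t\<in>{0..}. q (x \<oplus>\<^bsub>E\<^esub> of_real t \<odot>\<^bsub>E\<^esub> y) - t * q y)"

text \<open>The infimum has to be bounded below:
  \<open>t * q y = q (t y) \<le> q (- x) + q (x + t y)\<close> shows that every term is at least
  \<open>- q (- x)\<close>.\<close>

lemma tilt_le:
  assumes q: "real_sublinear E q" and xy: "x \<in> carrier E" "y \<in> carrier E" and "t \<ge> 0"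
  shows "tilt q y x \<le> q (x \<oplus>\<^bsub>E\<^esub> of_real t \<odot>\<^bsub>E\<^esub> y) - t * q y"
proof -
  have "- q (\<ominus>\<^bsub>E\<^esub> x) \<le> q (x \<oplus>\<^bsub>E\<^esub> of_real s \<odot>\<^bsub>E\<^esub> y) - s * q y" if "s \<ge> 0" for s
  proof -
    have "s * q y = q (of_real s \<odot>\<^bsub>E\<^esub> y)"
      using q xy that by (simp add: real_sublinear_smult)
    also have "of_real s \<odot>\<^bsub>E\<^esub> y = \<ominus>\<^bsub>E\<^esub> x \<oplus>\<^bsub>E\<^esub> (x \<oplus>\<^bsub>E\<^esub> of_real s \<odot>\<^bsub>E\<^esub> y)"
      using xy by (simp add: r_neg1)
    also have "q \<dots> \<le> q (\<ominus>\<^bsub>E\<^esub> x) + q (x \<oplus>\<^bsub>E\<^esub> of_real s \<odot>\<^bsub>E\<^esub> y)"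
      using q xy by (simp add: real_sublinear_add)
    finally show ?thesis by simp
  qed
  then have "bdd_below ((\<lambda>t. q (x \<oplus>\<^bsub>E\<^esub> of_real t \<odot>\<^bsub>E\<^esub> y) - t * q y) ` {0..})"
    by (intro bdd_belowI2[of _ "- q (\<ominus>\<^bsub>E\<^esub> x)"]) auto
  with \<open>t \<ge> 0\<close> show ?thesis
    unfolding tilt_def by (intro cINF_lower) auto
qed

lemma tilt_greatest:
  assumes "\<And>t. t \<ge> 0 \<Longrightarrow> c \<le> q (x \<oplus>\<^bsub>E\<^esub> of_real t \<odot>\<^bsub>E\<^esub> y) - t * q y"
  shows "c \<le> tilt q y x"
  unfolding tilt_def by (intro cINF_greatest) (use assms in auto)

lemma tilt_le_self:
  assumes "real_sublinear E q" "x \<in> carrier E" "y \<in> carrier E"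
  shows "tilt q y x \<le> q x"
  using tilt_le[OF assms, of 0] assms by simp

text \<open>Parameters \<open>t\<close> and \<open>t'\<close> for two summands combine into the
  admissible parameter \<open>t + t'\<close>, and scaling the argument by \<open>s\<close> scales
  the parameter by \<open>s\<close>.\<close>

lemma real_sublinear_tilt:
  assumes q: "real_sublinear E q" and y: "y \<in> carrier E"
  shows "real_sublinear E (tilt q y)"
proof (rule real_sublinearI)
  fix x x' assume x: "x \<in> carrier E" "x' \<in> carrier E"
  have *: "tilt q y (x \<oplus>\<^bsub>E\<^esub> x') \<le>
      (q (x \<oplus>\<^bsub>E\<^esub> of_real t \<odot>\<^bsub>E\<^esub> y) - t * q y) + (q (x' \<oplus>\<^bsub>E\<^esub> of_real t' \<odot>\<^bsub>E\<^esub> y) - t' * q y)"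
    if "t \<ge> 0" "t' \<ge> 0" for t t'
  proof -
    have "tilt q y (x \<oplus>\<^bsub>E\<^esub> x') \<le>
        q ((x \<oplus>\<^bsub>E\<^esub> x') \<oplus>\<^bsub>E\<^esub> of_real (t + t') \<odot>\<^bsub>E\<^esub> y) - (t + t') * q y"
      using x y q that by (intro tilt_le) auto
    also have "(x \<oplus>\<^bsub>E\<^esub> x') \<oplus>\<^bsub>E\<^esub> of_real (t + t') \<odot>\<^bsub>E\<^esub> y =
        (x \<oplus>\<^bsub>E\<^esub> of_real t \<odot>\<^bsub>E\<^esub> y) \<oplus>\<^bsub>E\<^esub> (x' \<oplus>\<^bsub>E\<^esub> of_real t' \<odot>\<^bsub>E\<^esub> y)"
      using x y by (simp add: smult_l_distr a_ac)
    also have "q \<dots> \<le> q (x \<oplus>\<^bsub>E\<^esub> of_real t \<odot>\<^bsub>E\<^esub> y) + q (x' \<oplus>\<^bsub>E\<^esub> of_real t' \<odot>\<^bsub>E\<^esub> y)"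
      using x y q by (simp add: real_sublinear_add)
    finally show ?thesis by (simp add: algebra_simps)
  qed
  \<comment> \<open>The infima over \<open>t'\<close> and \<open>t\<close> are taken one after the
    other.\<close>
  have "tilt q y (x \<oplus>\<^bsub>E\<^esub> x') - tilt q y x' \<le> tilt q y x"
  proof (rule tilt_greatest)
    fix t :: real assume t: "t \<ge> 0"
    have "tilt q y (x \<oplus>\<^bsub>E\<^esub> x') - (q (x \<oplus>\<^bsub>E\<^esub> of_real t \<odot>\<^bsub>E\<^esub> y) - t * q y) \<le> tilt q y x'"
      by (rule tilt_greatest) (use *[OF t] in \<open>simp add: algebra_simps\<close>)
    then show "tilt q y (x \<oplus>\<^bsub>E\<^esub> x') - tilt q y x' \<le> q (x \<oplus>\<^bsub>E\<^esub> of_real t \<odot>\<^bsub>E\<^esub> y) - t * q y"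
      by linarith
  qed
  then show "tilt q y (x \<oplus>\<^bsub>E\<^esub> x') \<le> tilt q y x + tilt q y x'" by simp
next
  have "q (\<zero>\<^bsub>E\<^esub> \<oplus>\<^bsub>E\<^esub> of_real t \<odot>\<^bsub>E\<^esub> y) - t * q y = 0" if "t \<ge> 0" for t
    using q y that by (simp add: real_sublinear_smult)
  then show "tilt q y \<zero>\<^bsub>E\<^esub> = 0"
    unfolding tilt_def by (simp cong: INF_cong_simp)
next
  fix s :: real and x assume s: "s > 0" and x: "x \<in> carrier E"
  have "tilt q y (of_real s \<odot>\<^bsub>E\<^esub> x) / s \<le> tilt q y x"
  proof (rule tilt_greatest)
    fix t :: real assume t: "t \<ge> 0"
    have "tilt q y (of_real s \<odot>\<^bsub>E\<^esub> x) \<le>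
        q (of_real s \<odot>\<^bsub>E\<^esub> x \<oplus>\<^bsub>E\<^esub> of_real (s * t) \<odot>\<^bsub>E\<^esub> y) - (s * t) * q y"
      using x y q s t by (intro tilt_le) auto
    also have "of_real s \<odot>\<^bsub>E\<^esub> x \<oplus>\<^bsub>E\<^esub> of_real (s * t) \<odot>\<^bsub>E\<^esub> y =
        of_real s \<odot>\<^bsub>E\<^esub> (x \<oplus>\<^bsub>E\<^esub> of_real t \<odot>\<^bsub>E\<^esub> y)"
      using x y by (simp add: smult_r_distr smult_smult)
    also have "q \<dots> = s * q (x \<oplus>\<^bsub>E\<^esub> of_real t \<odot>\<^bsub>E\<^esub> y)"
      using q s x y by (intro real_sublinear_smult) auto
    finally show "tilt q y (of_real s \<odot>\<^bsub>E\<^esub> x) / s \<le> q (x \<oplus>\<^bsub>E\<^esub> of_real t \<odot>\<^bsub>E\<^esub> y) - t * q y"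
      using s by (subst pos_divide_le_eq) (auto simp: algebra_simps)
  qed
  then show "tilt q y (of_real s \<odot>\<^bsub>E\<^esub> x) \<le> s * tilt q y x"
    using s by (subst (asm) pos_divide_le_eq) (auto simp: mult.commute)
qed

text \<open>Infima of sublinear functionals need not be subadditive. In a chain, however, the
  smaller of \<open>q\<close> and \<open>r\<close> lies below both, and its subadditivity gives the
  mixed bound \<open>q x + r y\<close>.\<close>

lemma real_sublinear_INF_chain:
  assumes "C \<noteq> {}" and sub: "\<And>q. q \<in> C \<Longrightarrow> real_sublinear E q"
    and bdd: "\<And>x. x \<in> carrier E \<Longrightarrow> bdd_below ((\<lambda>q. q x) ` C)"
    and chain: "\<And>q r. q \<in> C \<Longrightarrow> r \<in> C \<Longrightarrow>
      (\<forall>x\<in>carrier E. q x \<le> r x) \<or> (\<forall>x\<in>carrier E. r x \<le> q x)"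
  shows "real_sublinear E (\<lambda>x. INF q\<in>C. q x)"
proof (rule real_sublinearI)
  fix x y assume xy: "x \<in> carrier E" "y \<in> carrier E"
  let ?r = "\<lambda>x. INF q\<in>C. q x"
  have lower: "?r z \<le> q z" if "q \<in> C" "z \<in> carrier E" for q z
    using that bdd by (intro cINF_lower) auto
  have *: "?r (x \<oplus>\<^bsub>E\<^esub> y) \<le> q x + r y" if qr: "q \<in> C" "r \<in> C" for q r
  proof -
    obtain p where p: "p \<in> C" "p x \<le> q x" "p y \<le> r y"
      using chain[OF qr] qr xy by blast
    have "?r (x \<oplus>\<^bsub>E\<^esub> y) \<le> p (x \<oplus>\<^bsub>E\<^esub> y)"
      using p xy by (intro lower) auto
    also have "\<dots> \<le> p x + p y"
      using sub[OF p(1)] xy by (simp add: real_sublinear_add)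
    finally show ?thesis using p by simp
  qed
  have "?r (x \<oplus>\<^bsub>E\<^esub> y) - ?r y \<le> ?r x"
  proof (rule cINF_greatest[OF \<open>C \<noteq> {}\<close>])
    fix q assume "q \<in> C"
    have "?r (x \<oplus>\<^bsub>E\<^esub> y) - q x \<le> ?r y"
      by (rule cINF_greatest[OF \<open>C \<noteq> {}\<close>]) (use *[OF \<open>q \<in> C\<close>] in \<open>simp add: algebra_simps\<close>)
    then show "?r (x \<oplus>\<^bsub>E\<^esub> y) - ?r y \<le> q x" by simp
  qed
  then show "?r (x \<oplus>\<^bsub>E\<^esub> y) \<le> ?r x + ?r y" by simp
next
  have "q \<zero>\<^bsub>E\<^esub> = 0" if "q \<in> C" for q
    using sub[OF that] by (rule real_sublinear_zero)
  then have "(\<lambda>q. q \<zero>\<^bsub>E\<^esub>) ` C = {0}"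
    using \<open>C \<noteq> {}\<close> by force
  then show "(INF q\<in>C. q \<zero>\<^bsub>E\<^esub>) = 0" by simp
next
  fix t :: real and x assume t: "t > 0" and x: "x \<in> carrier E"
  have "(INF q\<in>C. q (of_real t \<odot>\<^bsub>E\<^esub> x)) / t \<le> (INF q\<in>C. q x)"
  proof (rule cINF_greatest[OF \<open>C \<noteq> {}\<close>])
    fix q assume q: "q \<in> C"
    have "(INF q\<in>C. q (of_real t \<odot>\<^bsub>E\<^esub> x)) \<le> q (of_real t \<odot>\<^bsub>E\<^esub> x)"
      using q x by (intro cINF_lower bdd) auto
    also have "\<dots> = t * q x"
      using sub[OF q] t x by (intro real_sublinear_smult) auto
    finally show "(INF q\<in>C. q (of_real t \<odot>\<^bsub>E\<^esub> x)) / t \<le> q x"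
      using t by (subst pos_divide_le_eq) (auto simp: mult.commute)
  qed
  then show "(INF q\<in>C. q (of_real t \<odot>\<^bsub>E\<^esub> x)) \<le> t * (INF q\<in>C. q x)"
    using t by (subst (asm) pos_divide_le_eq) (auto simp: mult.commute)
qed

text \<open>Zorn's lemma, with pointwise infima as lower bounds of chains. They are finite because
  every sublinear \<open>q\<close> below \<open>p\<close> satisfies
  \<open>q x \<ge> - q (- x) \<ge> - p (- x)\<close>.\<close>

lemma minimal_real_sublinear_exists:
  assumes p: "real_sublinear E p"
  obtains q where "real_sublinear E q" "\<And>x. x \<in> carrier E \<Longrightarrow> q x \<le> p x"
    "\<And>r x. real_sublinear E r \<Longrightarrow> (\<And>x. x \<in> carrier E \<Longrightarrow> r x \<le> q x) \<Longrightarrow> x \<in> carrier E \<Longrightarrow> r x = q x"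
proof -
  let ?A = "{q. real_sublinear E q \<and> (\<forall>x\<in>carrier E. q x \<le> p x) \<and> (\<forall>x. x \<notin> carrier E \<longrightarrow> q x = 0)}"
  \<comment> \<open>The order is reversed, since Zorn's lemma yields maximal elements.\<close>
  let ?P = "\<lambda>q r. \<forall>x\<in>carrier E. r x \<le> q x"
  \<comment> \<open>The order compares values on the carrier only; fixing the other values to 0
    makes it antisymmetric.\<close>
  define cut where "cut = (\<lambda>r x. if x \<in> carrier E then r x else (0::real))"
  have cut: "cut r \<in> ?A" if "real_sublinear E r" "\<And>x. x \<in> carrier E \<Longrightarrow> r x \<le> p x" for r
    using that by (auto simp: cut_def real_sublinear_def)
  have "\<exists>m\<in>?A. \<forall>a\<in>?A. ?P m a \<longrightarrow> a = m"
  proof (rule predicate_Zorn)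
    show "partial_order_on ?A (relation_of ?P ?A)"
    proof (rule partial_order_on_relation_ofI)
      show "q = r" if "q \<in> ?A" "r \<in> ?A" "?P q r" "?P r q" for q r
      proof
        fix x show "q x = r x"
          using that by (cases "x \<in> carrier E") (auto intro: antisym)
      qed
    qed (auto intro: order_trans)
  next
    fix C assume C: "C \<in> Chains (relation_of ?P ?A)"
    then have CA: "C \<subseteq> ?A" by (rule Chains_relation_of)
    show "\<exists>u\<in>?A. \<forall>a\<in>C. ?P a u"
    proof (cases "C = {}")
      case True
      then show ?thesis using cut[OF p] by auto
    next
      case False
      let ?r = "\<lambda>x. INF q\<in>C. q x"
      have bdd: "bdd_below ((\<lambda>q. q x) ` C)" if "x \<in> carrier E" for x
      proof (rule bdd_belowI2)
        fix q assume "q \<in> C"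
        then have "real_sublinear E q" "q (\<ominus>\<^bsub>E\<^esub> x) \<le> p (\<ominus>\<^bsub>E\<^esub> x)"
          using CA that by auto
        then show "- p (\<ominus>\<^bsub>E\<^esub> x) \<le> q x"
          using real_sublinear_uminus[of q x] that by simp
      qed
      have lower: "?r x \<le> q x" if "q \<in> C" "x \<in> carrier E" for q x
        using that bdd by (intro cINF_lower) auto
      have "real_sublinear E ?r"
        using C CA False bdd
        by (intro real_sublinear_INF_chain) (auto simp: Chains_def relation_of_def)
      moreover have "?r x \<le> p x" if "x \<in> carrier E" for x
      proof -
        obtain q where "q \<in> C" using False by blast
        then show ?thesis using lower[of q x] CA that by force
      qed
      ultimately have "cut ?r \<in> ?A" by (rule cut)
      moreover have "?P q (cut ?r)" if "q \<in> C" for q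
        using lower that by (simp add: cut_def)
      ultimately show ?thesis by blast
    qed
  qed
  then obtain q where q: "q \<in> ?A" and min: "\<And>r. r \<in> ?A \<Longrightarrow> ?P q r \<Longrightarrow> r = q" by blast
  show thesis
  proof (rule that)
    fix r x assume r: "real_sublinear E r" "\<And>x. x \<in> carrier E \<Longrightarrow> r x \<le> q x" and x: "x \<in> carrier E"
    have "r x \<le> p x" if "x \<in> carrier E" for x
      using r(2)[OF that] q that by (auto intro: order_trans)
    then have "cut r = q"
      using r by (intro min cut) (auto simp: cut_def)
    with x show "r x = q x" by (auto simp: cut_def)
  qed (use q in auto)
qed

text \<open>
  A minimal sublinear functional \<open>q\<close> agrees with its tilts, and \<open>q x = tilt q y x \<le> q (x + y) - q y\<close>
  makes it additive. Minimising below the tilt of the norm at \<open>x\<^sub>0\<close> forces the value \<open>nrm E x\<^sub>0\<close> at \<open>x\<^sub>0\<close>.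
\<close>

lemma real_Hahn_Banach:
  assumes x0: "x0 \<in> carrier E"
  obtains g where "\<And>x y. x \<in> carrier E \<Longrightarrow> y \<in> carrier E \<Longrightarrow> g (x \<oplus>\<^bsub>E\<^esub> y) = g x + g y"
    "\<And>t x. x \<in> carrier E \<Longrightarrow> g (of_real t \<odot>\<^bsub>E\<^esub> x) = t * g x"
    "\<And>x. x \<in> carrier E \<Longrightarrow> g x \<le> nrm E x" "g x0 = nrm E x0"
proof -
  obtain q where q: "real_sublinear E q"
    and le: "\<And>x. x \<in> carrier E \<Longrightarrow> q x \<le> tilt (nrm E) x0 x"
    and min: "\<And>r x. real_sublinear E r \<Longrightarrow> (\<And>x. x \<in> carrier E \<Longrightarrow> r x \<le> q x) \<Longrightarrow> x \<in> carrier E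
      \<Longrightarrow> r x = q x"
    using minimal_real_sublinear_exists[OF real_sublinear_tilt[OF real_sublinear_nrm x0]] by blast
  have add: "q (x \<oplus>\<^bsub>E\<^esub> y) = q x + q y" if "x \<in> carrier E" "y \<in> carrier E" for x y
  proof (rule antisym)
    show "q (x \<oplus>\<^bsub>E\<^esub> y) \<le> q x + q y"
      using q that by (simp add: real_sublinear_add)
    have "q x = tilt q y x"
      using q that by (intro min[symmetric] real_sublinear_tilt tilt_le_self)
    also have "\<dots> \<le> q (x \<oplus>\<^bsub>E\<^esub> y) - q y"
      using tilt_le[OF q that, of 1] that by simp
    finally show "q x + q y \<le> q (x \<oplus>\<^bsub>E\<^esub> y)" by simp
  qed
  have uminus: "q (\<ominus>\<^bsub>E\<^esub> x) = - q x" if "x \<in> carrier E" for x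
    using add[of x "\<ominus>\<^bsub>E\<^esub> x"] that real_sublinear_zero[OF q] by (simp add: r_neg)
  have pos: "q (of_real t \<odot>\<^bsub>E\<^esub> x) = t * q x" if "x \<in> carrier E" "t \<ge> 0" for t x
    using q that by (simp add: real_sublinear_smult)
  have smult: "q (of_real t \<odot>\<^bsub>E\<^esub> x) = t * q x" if x: "x \<in> carrier E" for t x
  proof (cases "t \<ge> 0")
    case False
    have "q (of_real t \<odot>\<^bsub>E\<^esub> x) = q (\<ominus>\<^bsub>E\<^esub> (of_real (- t) \<odot>\<^bsub>E\<^esub> x))"
      using x by (simp add: smult_minus_1[symmetric] smult_smult)
    also have "\<dots> = t * q x"
      using False x by (simp only: uminus smult_closed pos[of x "- t"])
    finally show ?thesis .
  qed (use x pos in auto)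
  have nrm: "q x \<le> nrm E x" if "x \<in> carrier E" for x
    using le[OF that] tilt_le_self[OF real_sublinear_nrm that x0] by simp
  \<comment> \<open>The parameter \<open>t = 1\<close> gives
    \<open>q (- x0) \<le> - nrm E x0\<close>, which additivity turns into the missing lower bound
    for \<open>q x0\<close>.\<close>
  have "tilt (nrm E) x0 (\<ominus>\<^bsub>E\<^esub> x0) \<le> - nrm E x0"
    using tilt_le[OF real_sublinear_nrm _ x0, of "\<ominus>\<^bsub>E\<^esub> x0" 1] x0 by (simp add: l_neg)
  then have "q x0 = nrm E x0"
    using le[of "\<ominus>\<^bsub>E\<^esub> x0"] nrm[OF x0] uminus x0 by simp
  with add smult nrm show thesis by (rule that)
qed

end


subsection \<open>The norm of the scalar field\<close>

lemma norm_imaginary_unit: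
  fixes i :: "'k::real_normed_field"
  assumes "i * i = - 1"
  shows "norm i = 1"
proof -
  have "(norm i)\<^sup>2 = norm (i * i)"
    by (simp add: power2_eq_square norm_mult)
  then show ?thesis
    using assms by (simp add: power2_eq_1_iff) (use norm_ge_zero[of i] in linarith)
qed

text \<open>The powers of a point of the unit circle stay on the circle, where the norm is at most 2.\<close>

lemma norm_unit_circle_le:
  fixes i :: "'k::real_normed_field"
  assumes i: "i * i = - 1" and ab: "a\<^sup>2 + b\<^sup>2 = 1"
  shows "norm (of_real a + of_real b * i) \<le> 1"
proof (rule ccontr)
  let ?z = "of_real a + of_real b * i"
  assume "\<not> norm ?z \<le> 1"
  then obtain n where n: "2 < norm ?z ^ n"
    using real_arch_pow[of "norm ?z" 2] by auto
  have "\<exists>c d. c\<^sup>2 + d\<^sup>2 = 1 \<and> ?z ^ n = of_real c + of_real d * i"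
  proof (induction n)
    case 0
    have "(1::real)\<^sup>2 + 0\<^sup>2 = 1 \<and> ?z ^ 0 = of_real 1 + of_real 0 * i" by simp
    then show ?case by blast
  next
    case (Suc n)
    then obtain c d where cd: "c\<^sup>2 + d\<^sup>2 = 1" "?z ^ n = of_real c + of_real d * i" by blast
    have "(a * c - b * d)\<^sup>2 + (a * d + b * c)\<^sup>2 = (a\<^sup>2 + b\<^sup>2) * (c\<^sup>2 + d\<^sup>2)"
      by (simp add: power2_eq_square algebra_simps)
    moreover have "?z ^ Suc n = of_real (a * c) + of_real (b * d) * (i * i) + of_real (a * d + b * c) * i"
      unfolding power_Suc cd(2) by (simp add: algebra_simps)
    then have "?z ^ Suc n = of_real (a * c - b * d) + of_real (a * d + b * c) * i"
      by (simp add: i)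
    ultimately show ?case
      using ab cd(1) by (metis mult_1)
  qed
  then obtain c d where cd: "c\<^sup>2 + d\<^sup>2 = 1" "?z ^ n = of_real c + of_real d * i" by blast
  have "norm (?z ^ n) \<le> norm (of_real c :: 'k) + norm (of_real d * i)"
    unfolding cd(2) by (rule norm_triangle_ineq)
  also have "\<dots> = \<bar>c\<bar> + \<bar>d\<bar>"
    by (simp add: norm_mult norm_imaginary_unit[OF i])
  also have "\<dots> \<le> 2"
  proof -
    have "c\<^sup>2 \<le> 1" "d\<^sup>2 \<le> 1"
      using cd(1) zero_le_power2[of c] zero_le_power2[of d] by linarith+
    then show ?thesis by (simp add: abs_square_le_1)
  qed
  finally show False
    using n by (simp add: norm_power)
qed

text \<open>Scaling to the unit circle bounds the norms of the number and of its conjugate by the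
  modulus \<open>r\<close>. Their product is exactly \<open>r * r\<close>, so neither can be smaller
  than \<open>r\<close>.\<close>

lemma norm_complex_coordinates:
  fixes i :: "'k::real_normed_field"
  assumes i: "i * i = - 1"
  shows "(norm (of_real a + of_real b * i))\<^sup>2 = a\<^sup>2 + b\<^sup>2"
proof (cases "a\<^sup>2 + b\<^sup>2 = 0")
  case True
  then show ?thesis by (simp add: sum_power2_eq_zero_iff)
next
  case False
  define r where "r = sqrt (a\<^sup>2 + b\<^sup>2)"
  have r: "r > 0" "r\<^sup>2 = a\<^sup>2 + b\<^sup>2"
    using False by (auto simp: r_def add_nonneg_pos sum_power2_gt_zero_iff sum_power2_eq_zero_iff)
  \<comment> \<open>Any \<open>c\<close> with the same square as \<open>b\<close> is allowed, which
    covers the number and its conjugate at once.\<close>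
  have le: "norm (of_real a + of_real c * i) \<le> r" if "c\<^sup>2 = b\<^sup>2" for c
  proof -
    have "(a / r)\<^sup>2 + (c / r)\<^sup>2 = 1"
      using r that False by (simp add: power_divide add_divide_distrib[symmetric] del: sum_power2_eq_zero_iff)
    then have "norm (of_real (a / r) + of_real (c / r) * i) \<le> 1"
      by (rule norm_unit_circle_le[OF i])
    moreover have "of_real a + of_real c * i = of_real r * (of_real (a / r) + of_real (c / r) * i)"
      using r by (simp add: algebra_simps)
    ultimately show ?thesis
      using r by (simp add: norm_mult mult_left_le del: of_real_divide)
  qed
  let ?p = "norm (of_real a + of_real b * i)" and ?m = "norm (of_real a + of_real (- b) * i)"
  have "?p * ?m = norm (of_real (a * a) - of_real (b * b) * (i * i))"
    by (simp add: norm_mult[symmetric] algebra_simps)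
  also have "\<dots> = norm (of_real (a\<^sup>2 + b\<^sup>2) :: 'k)"
    by (simp add: i power2_eq_square)
  also have "\<dots> = r * r"
    unfolding norm_of_real using r by (simp add: power2_eq_square)
  finally have prod: "?p * ?m = r * r" .
  have "?p \<le> r" "?m \<le> r"
    by (rule le; simp)+
  have "r * r \<le> ?p * r"
    unfolding prod[symmetric] using \<open>?m \<le> r\<close> by (intro mult_left_mono) auto
  then have "?p = r"
    using \<open>?p \<le> r\<close> r by simp
  then show ?thesis using r by simp
qed

lemma real_or_complex_coordinates:
  obtains (real) "\<forall>x::'k::real_or_complex. \<exists>r. x = of_real r"
  | (complex) i :: "'k::real_or_complex" where "i * i = - 1"
      "\<forall>x. \<exists>a b. x = of_real a + of_real b * i"
  using real_or_complex[where 'a = 'k] by (metis of_real_def scaleR_conv_of_real)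

text \<open>A ball of scalars lies in the continuous image of an interval or of a square of real
  coordinates. This is the compactness behind limits of bounded scalar sequences.\<close>

lemma bounded_subset_compact:
  obtains S :: "'k::real_or_complex set" where "compact S" "\<And>x. norm x \<le> B \<Longrightarrow> x \<in> S"
proof (cases rule: real_or_complex_coordinates[where 'k = 'k])
  case real
  have "compact ((of_real :: real \<Rightarrow> 'k) ` {- B..B})"
    by (intro compact_continuous_image continuous_intros) auto
  moreover have "x \<in> of_real ` {- B..B}" if "norm x \<le> B" for x :: 'k
  proof -
    obtain r where "x = of_real r" using real by blast
    with that show ?thesis by (auto simp: abs_le_iff)
  qed
  ultimately show thesis by (rule that)
next
  case (complex i)
  let ?f = "\<lambda>(a, b). of_real a + of_real b * i"
  have "compact (?f ` ({- B..B} \<times> {- B..B}))"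
    unfolding case_prod_beta
    by (intro compact_continuous_image continuous_intros compact_Times) auto
  moreover have "x \<in> ?f ` ({- B..B} \<times> {- B..B})" if "norm x \<le> B" for x
  proof -
    obtain a b where x: "x = of_real a + of_real b * i" using complex by blast
    have "a\<^sup>2 + b\<^sup>2 \<le> B\<^sup>2"
      using norm_complex_coordinates[OF complex(1), of a b] x that
      by (metis norm_ge_zero power_mono)
    then have "a\<^sup>2 \<le> B\<^sup>2" "b\<^sup>2 \<le> B\<^sup>2"
      using zero_le_power2[of a] zero_le_power2[of b] by linarith+
    then have "\<bar>a\<bar> \<le> B" "\<bar>b\<bar> \<le> B"
      using order_trans[OF norm_ge_zero that] by (simp_all add: abs_le_square_iff[symmetric])
    then show ?thesis
      using x by (intro image_eqI[of _ _ "(a, b)"]) auto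
  qed
  ultimately show thesis by (rule that)
qed


subsection \<open>Limits along an ultrafilter\<close>

text \<open>Compactness gives a cluster point of the image filter. An ultrafilter decides every
  neighbourhood of it, so the cluster point is a limit.\<close>

lemma ultrafilter_limit_compact:
  assumes U: "free_ultrafilter U" and S: "compact S" and f: "\<And>n. f n \<in> S"
  obtains l where "(f \<longlongrightarrow> l) U"
proof -
  have "filtermap f U \<noteq> bot" "eventually (\<lambda>x. x \<in> S) (filtermap f U)"
    using U f by (auto simp: free_ultrafilter_def filtermap_bot_iff eventually_filtermap)
  with S obtain l where l: "inf (nhds l) (filtermap f U) \<noteq> bot"
    unfolding compact_filter by blast
  have "(f \<longlongrightarrow> l) U"
  proof (rule topological_tendstoI, rule ccontr)
    fix A assume A: "open A" "l \<in> A" "\<not> (\<forall>\<^sub>F n in U. f n \<in> A)"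
    then have "\<forall>\<^sub>F n in U. f n \<notin> A"
      using U by (auto simp: free_ultrafilter_def)
    moreover have "\<forall>\<^sub>F x in nhds l. x \<in> A"
      using A by (simp add: eventually_nhds_in_open)
    ultimately have "eventually (\<lambda>x. False) (inf (nhds l) (filtermap f U))"
      unfolding eventually_inf eventually_filtermap
      by (intro exI[of _ "\<lambda>x. x \<in> A"] exI[of _ "\<lambda>x. x \<notin> A"]) auto
    with l show False by (simp add: trivial_limit_def)
  qed
  then show thesis by (rule that)
qed

lemma ultrafilter_limit_bounded:
  fixes f :: "nat \<Rightarrow> 'k::real_or_complex"
  assumes "free_ultrafilter U" "\<And>n. norm (f n) \<le> B"
  obtains l where "(f \<longlongrightarrow> l) U"
proof -
  obtain S :: "'k set" where "compact S" "\<And>x. norm x \<le> B \<Longrightarrow> x \<in> S"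
    using bounded_subset_compact[where B = B] by metis
  with assms that show thesis
    by (meson ultrafilter_limit_compact)
qed


subsection \<open>Bounded functionals\<close>

lemma bdd_above_opnorm:
  assumes T: "T \<in> bounded_ops E F" and nonneg: "\<And>y. y \<in> carrier E \<Longrightarrow> 0 \<le> nrm E y"
  shows "bdd_above ((\<lambda>x. nrm F (T x)) ` {x \<in> carrier E. nrm E x \<le> 1})"
proof -
  from T obtain C where C: "\<And>y. y \<in> carrier E \<Longrightarrow> nrm F (T y) \<le> C * nrm E y"
    unfolding bounded_ops_def by blast
  show ?thesis
  proof (rule bdd_aboveI2)
    fix x assume x: "x \<in> {x \<in> carrier E. nrm E x \<le> 1}"
    then have "nrm F (T x) \<le> C * nrm E x" using C by simp
    \<comment> \<open>The sign of \<open>C\<close> is unknown, hence the absolute value.\<close>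
    also have "\<dots> \<le> \<bar>C\<bar> * 1" using x nonneg by (intro mult_mono) auto
    finally show "nrm F (T x) \<le> \<bar>C\<bar>" by simp
  qed
qed

text \<open>The norm properties appear as hypotheses instead of the locale
  \<open>banach_space\<close>, so that the estimate applies to functionals on the ultraproduct
  without first proving that it is a Banach space.\<close>

lemma nrm_le_opnorm:
  assumes T: "T \<in> bounded_ops E F" and x: "x \<in> carrier E"
    and nonneg: "\<And>y. y \<in> carrier E \<Longrightarrow> 0 \<le> nrm E y"
    and closed: "\<And>a y. y \<in> carrier E \<Longrightarrow> a \<odot>\<^bsub>E\<^esub> y \<in> carrier E"
    and smultE: "\<And>a y. y \<in> carrier E \<Longrightarrow> nrm E (a \<odot>\<^bsub>E\<^esub> y) = norm a * nrm E y"
    and smultF: "\<And>a y. y \<in> carrier F \<Longrightarrow> nrm F (a \<odot>\<^bsub>F\<^esub> y) = norm a * nrm F y"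
  shows "nrm F (T x) \<le> opnorm E F T * nrm E x"
proof -
  from T obtain C where C: "\<And>y. y \<in> carrier E \<Longrightarrow> nrm F (T y) \<le> C * nrm E y"
    unfolding bounded_ops_def by blast
  show ?thesis
  proof (cases "nrm E x = 0")
    \<comment> \<open>Normalising \<open>x\<close> is impossible here; the bound by \<open>C\<close>
      already makes the left side at most 0.\<close>
    case True
    then show ?thesis using C[OF x] by simp
  next
    case False
    then have pos: "nrm E x > 0" using nonneg[OF x] by simp
    let ?a = "of_real (1 / nrm E x)"
    have "nrm F (T (?a \<odot>\<^bsub>E\<^esub> x)) \<le> opnorm E F T"
      unfolding opnorm_def using x closed smultE pos
      by (intro cSUP_upper bdd_above_opnorm[OF T nonneg]) (auto simp: norm_divide)
    also have "T (?a \<odot>\<^bsub>E\<^esub> x) = ?a \<odot>\<^bsub>F\<^esub> T x"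
      using T x by (auto simp: bounded_ops_def)
    also have "nrm F \<dots> = nrm F (T x) / nrm E x"
      using T x pos by (subst smultF) (auto simp: bounded_ops_def norm_divide)
    finally show ?thesis
      using pos by (simp add: pos_divide_le_eq)
  qed
qed

lemma scalar_space_simps [simp]:
  "carrier scalar_space = UNIV" "nrm scalar_space = norm"
  "add scalar_space = (+)" "module.smult scalar_space = (*)"
  by (auto simp: scalar_space_def)

text \<open>The pointwise bound gives operator norm at most 1, and the unit vector \<open>x\<close>
  attains it. Support functionals and ultralimits of functionals are both recognised in this
  way.\<close>

lemma dual_unit_sphereI:
  assumes add: "\<And>x y. x \<in> carrier E \<Longrightarrow> y \<in> carrier E \<Longrightarrow> f (x \<oplus>\<^bsub>E\<^esub> y) = f x + f y"
    and smult: "\<And>a x. x \<in> carrier E \<Longrightarrow> f (a \<odot>\<^bsub>E\<^esub> x) = a * f x"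
    and le: "\<And>x. x \<in> carrier E \<Longrightarrow> norm (f x) \<le> nrm E x"
    and x: "x \<in> unit_sphere E" "f x = 1"
  shows "f \<in> dual_unit_sphere E"
proof -
  have "f \<in> bounded_ops E scalar_space"
    unfolding bounded_ops_def using add smult le by (auto intro!: exI[of _ 1])
  moreover have "opnorm E scalar_space f = 1"
  proof (rule antisym)
    show "opnorm E scalar_space f \<le> 1"
      unfolding opnorm_def using x
      by (intro cSUP_least) (auto simp: unit_sphere_def intro: order_trans[OF le])
    have "norm (f x) \<le> opnorm E scalar_space f"
      unfolding opnorm_def scalar_space_simps using x
      by (intro cSUP_upper bdd_aboveI2[of _ _ 1])
        (auto simp: unit_sphere_def intro: order_trans[OF le])
    then show "1 \<le> opnorm E scalar_space f"
      using x by simp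
  qed
  ultimately show ?thesis by (simp add: dual_unit_sphere_def)
qed

section \<open>Support functionals of unit vectors\<close>

context banach_space
begin

lemma nrm_bounded_op_le:
  "T \<in> bounded_ops E E \<Longrightarrow> x \<in> carrier E \<Longrightarrow> nrm E (T x) \<le> opnorm E E T * nrm E x"
  by (rule nrm_le_opnorm) (auto simp: nrm_smult)

lemma dual_unit_sphere_le:
  assumes f: "f \<in> dual_unit_sphere E" and x: "x \<in> carrier E"
  shows "norm (f x) \<le> nrm E x"
  using nrm_le_opnorm[of f E scalar_space x] f x
  by (simp add: dual_unit_sphere_def nrm_smult norm_mult)

text \<open>The real Hahn-Banach functional \<open>g\<close> is the answer over the reals. Over the
  complex numbers it is the real part of the answer, and a rotation of the argument transfers its
  norm bound.\<close>

lemma support_functional_exists: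
  assumes x0: "x0 \<in> unit_sphere E"
  obtains f where "f \<in> dual_unit_sphere E" "f x0 = 1"
proof -
  have "x0 \<in> carrier E" "nrm E x0 = 1" using x0 by (auto simp: unit_sphere_def)
  then obtain g where add: "\<And>x y. x \<in> carrier E \<Longrightarrow> y \<in> carrier E \<Longrightarrow> g (x \<oplus>\<^bsub>E\<^esub> y) = g x + g y"
    and smult: "\<And>t x. x \<in> carrier E \<Longrightarrow> g (of_real t \<odot>\<^bsub>E\<^esub> x) = t * g x"
    and le: "\<And>x. x \<in> carrier E \<Longrightarrow> g x \<le> nrm E x" and g1: "g x0 = 1"
    using real_Hahn_Banach by (metis (no_types, lifting))
  have neg: "g ((- 1) \<odot>\<^bsub>E\<^esub> x) = - g x" if "x \<in> carrier E" for x
    using smult[OF that, of "- 1"] by simp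
  show thesis
  proof (cases rule: real_or_complex_coordinates[where 'k = 'k])
    case real
    let ?f = "\<lambda>x. of_real (g x) :: 'k"
    show thesis
    proof (rule that)
      show "?f \<in> dual_unit_sphere E"
      proof (rule dual_unit_sphereI[OF _ _ _ x0])
        show "?f (a \<odot>\<^bsub>E\<^esub> x) = a * ?f x" if "x \<in> carrier E" for a x
          using real[rule_format, of a] smult[OF that] by auto
        show "norm (?f x) \<le> nrm E x" if "x \<in> carrier E" for x
          using le[OF that] le[of "(- 1) \<odot>\<^bsub>E\<^esub> x"] neg that by (simp add: smult_minus_1)
      qed (auto simp: add g1)
    qed (simp add: g1)
  next
    case (complex i)
    \<comment> \<open>The complex-linear functional with real part \<open>g\<close>.\<close>
    let ?f = "\<lambda>x. of_real (g x) + of_real (- g (i \<odot>\<^bsub>E\<^esub> x)) * i"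
    have f_add: "?f (x \<oplus>\<^bsub>E\<^esub> y) = ?f x + ?f y" if "x \<in> carrier E" "y \<in> carrier E" for x y
      using that by (simp add: add smult_r_distr algebra_simps)
    have f_smult: "?f (a \<odot>\<^bsub>E\<^esub> x) = a * ?f x" if x: "x \<in> carrier E" for a x
    proof -
      obtain s t where a: "a = of_real s + of_real t * i" using complex by blast
      have "a \<odot>\<^bsub>E\<^esub> x = of_real s \<odot>\<^bsub>E\<^esub> x \<oplus>\<^bsub>E\<^esub> of_real t \<odot>\<^bsub>E\<^esub> (i \<odot>\<^bsub>E\<^esub> x)"
        using x by (simp add: a smult_l_distr smult_smult)
      then have 1: "g (a \<odot>\<^bsub>E\<^esub> x) = s * g x + t * g (i \<odot>\<^bsub>E\<^esub> x)"
        using x by (simp add: add smult)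
      have "i * a = of_real s * i + of_real t * (i * i)"
        by (simp add: a algebra_simps)
      then have "i \<odot>\<^bsub>E\<^esub> (a \<odot>\<^bsub>E\<^esub> x) = of_real s \<odot>\<^bsub>E\<^esub> (i \<odot>\<^bsub>E\<^esub> x) \<oplus>\<^bsub>E\<^esub> of_real (- t) \<odot>\<^bsub>E\<^esub> x"
        using x complex(1) by (simp add: smult_smult smult_l_distr[symmetric])
      then have 2: "g (i \<odot>\<^bsub>E\<^esub> (a \<odot>\<^bsub>E\<^esub> x)) = s * g (i \<odot>\<^bsub>E\<^esub> x) - t * g x"
        using x by (simp add: add smult del: of_real_minus)
      have "a * ?f x = of_real (s * g x) - of_real (t * g (i \<odot>\<^bsub>E\<^esub> x)) * (i * i)
          + of_real (t * g x - s * g (i \<odot>\<^bsub>E\<^esub> x)) * i"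
        by (simp add: a algebra_simps)
      then show ?thesis
        unfolding 1 2 complex(1) by simp
    qed
    have f_le: "norm (?f x) \<le> nrm E x" if x: "x \<in> carrier E" for x
    proof (cases "?f x = 0")
      case True
      show ?thesis unfolding True using x by simp
    next
      case False
      \<comment> \<open>The unimodular factor \<open>u\<close> rotates \<open>x\<close> so that the
        value of the functional becomes the nonnegative real \<open>c\<close>.\<close>
      define c where "c = norm (?f x)"
      define u where "u = of_real c / ?f x"
      have "norm u = 1"
        using False by (simp add: u_def c_def norm_divide)
      have "?f (u \<odot>\<^bsub>E\<^esub> x) = of_real c"
        unfolding f_smult[OF x] using False by (simp add: u_def)
      \<comment> \<open>A scalar of norm 0 has both coordinates 0, so \<open>c\<close> is the value
        of \<open>g\<close> at the rotated vector.\<close>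
      then have "of_real (g (u \<odot>\<^bsub>E\<^esub> x) - c) + of_real (- g (i \<odot>\<^bsub>E\<^esub> (u \<odot>\<^bsub>E\<^esub> x))) * i = 0"
        by (simp add: algebra_simps)
      then have "(g (u \<odot>\<^bsub>E\<^esub> x) - c)\<^sup>2 + (- g (i \<odot>\<^bsub>E\<^esub> (u \<odot>\<^bsub>E\<^esub> x)))\<^sup>2 = 0"
        using norm_complex_coordinates[OF complex(1)] by (metis norm_zero zero_power2)
      then have "c = g (u \<odot>\<^bsub>E\<^esub> x)"
        by (simp add: sum_power2_eq_zero_iff)
      also have "\<dots> \<le> nrm E (u \<odot>\<^bsub>E\<^esub> x)"
        using x by (intro le) auto
      also have "\<dots> = nrm E x"
        using x \<open>norm u = 1\<close> by (simp add: nrm_smult)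
      finally show ?thesis by (simp add: c_def)
    qed
    have x0': "x0 \<in> carrier E" "nrm E x0 = 1" by fact+
    \<comment> \<open>The real coordinate at \<open>x0\<close> is already 1; norm at most 1 leaves
      no room for an imaginary one.\<close>
    have "1 + (- g (i \<odot>\<^bsub>E\<^esub> x0))\<^sup>2 = (norm (?f x0))\<^sup>2"
      unfolding norm_complex_coordinates[OF complex(1)] by (simp add: g1)
    also have "\<dots> \<le> 1\<^sup>2"
      using f_le[OF x0'(1)] x0' by (intro power_mono) auto
    finally have "?f x0 = 1" by (simp add: g1)
    with f_add f_smult f_le x0 show thesis
      by (intro that[of ?f] dual_unit_sphereI[of E ?f x0]) auto
  qed
qed

end


subsection \<open>The numerical radius of a bounded operator\<close>

context banach_space
begin

lemma numerical_radius_range_le: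
  assumes T: "T \<in> bounded_ops E E" and xf: "x \<in> unit_sphere E" "f \<in> dual_unit_sphere E"
  shows "norm (f (T x)) \<le> opnorm E E T"
proof -
  have "T x \<in> carrier E"
    using T xf by (auto simp: bounded_ops_def unit_sphere_def)
  then have "norm (f (T x)) \<le> nrm E (T x)"
    by (rule dual_unit_sphere_le[OF xf(2)])
  also have "\<dots> \<le> opnorm E E T"
    using nrm_bounded_op_le[OF T, of x] xf by (simp add: unit_sphere_def)
  finally show ?thesis .
qed

lemma opnorm_nonneg:
  assumes T: "T \<in> bounded_ops E E"
  shows "0 \<le> opnorm E E T"
proof -
  have Tc: "T x \<in> carrier E" if "x \<in> carrier E" for x
    using T that by (auto simp: bounded_ops_def)
  have "0 \<le> nrm E (T \<zero>\<^bsub>E\<^esub>)" using Tc by simp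
  also have "\<dots> \<le> opnorm E E T"
    unfolding opnorm_def by (intro cSUP_upper bdd_above_opnorm[OF T]) auto
  finally show ?thesis .
qed

lemma bdd_above_numerical_range:
  assumes "T \<in> bounded_ops E E"
  shows "bdd_above (insert 0
    {norm (f (T x)) | x f. x \<in> unit_sphere E \<and> f \<in> dual_unit_sphere E \<and> f x = 1})"
  using numerical_radius_range_le[OF assms] by (auto intro!: bdd_aboveI)

lemma numerical_radius_upper:
  assumes "T \<in> bounded_ops E E" "x \<in> unit_sphere E" "f \<in> dual_unit_sphere E" "f x = 1"
  shows "norm (f (T x)) \<le> numerical_radius E T"
  unfolding numerical_radius_def
  by (intro cSup_upper bdd_above_numerical_range) (use assms in auto)

lemma numerical_radius_nonneg:
  "T \<in> bounded_ops E E \<Longrightarrow> 0 \<le> numerical_radius E T"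
  unfolding numerical_radius_def by (intro cSup_upper bdd_above_numerical_range) auto

lemma numerical_radius_le_opnorm:
  "T \<in> bounded_ops E E \<Longrightarrow> numerical_radius E T \<le> opnorm E E T"
  unfolding numerical_radius_def
  by (intro cSup_least) (auto intro: numerical_radius_range_le opnorm_nonneg)

text \<open>A support functional \<open>f\<close> at the normalised \<open>y\<close> has
  \<open>f y = nrm E y\<close>, and \<open>norm (f (T y))\<close> is at most
  \<open>numerical_radius E T * nrm E y\<close>. Evaluating \<open>f\<close> at
  \<open>y - a T y\<close> bounds the norm of that vector from below.\<close>

lemma nrm_minus_op_ge:
  assumes T: "T \<in> bounded_ops E E" and y: "y \<in> carrier E"
  shows "(1 - norm a * numerical_radius E T) * nrm E y \<le> nrm E (y \<oplus>\<^bsub>E\<^esub> (- a) \<odot>\<^bsub>E\<^esub> T y)"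
proof (cases "nrm E y = 0")
  case True
  have "T y \<in> carrier E" using T y by (auto simp: bounded_ops_def)
  then show ?thesis using True y by simp
next
  case False
  then have pos: "nrm E y > 0" using y nrm_nonneg[OF y] by linarith
  have Ty: "T y \<in> carrier E" using T y by (auto simp: bounded_ops_def)
  let ?s = "of_real (1 / nrm E y) :: 'k"
  have s: "?s \<odot>\<^bsub>E\<^esub> y \<in> unit_sphere E"
    using y pos by (simp add: unit_sphere_def nrm_smult norm_divide)
  then obtain f where f: "f \<in> dual_unit_sphere E" "f (?s \<odot>\<^bsub>E\<^esub> y) = 1"
    by (rule support_functional_exists)
  have f_add: "f (x \<oplus>\<^bsub>E\<^esub> z) = f x + f z" if "x \<in> carrier E" "z \<in> carrier E" for x z
    using f that by (simp add: dual_unit_sphere_def bounded_ops_def)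
  have f_smult: "f (b \<odot>\<^bsub>E\<^esub> x) = b * f x" if "x \<in> carrier E" for b x
    using f that by (simp add: dual_unit_sphere_def bounded_ops_def)
  have fy: "f y = of_real (nrm E y)"
    using f(2) f_smult[OF y] pos by (simp add: field_simps)
  have "T (?s \<odot>\<^bsub>E\<^esub> y) = ?s \<odot>\<^bsub>E\<^esub> T y"
    using T y unfolding bounded_ops_def by blast
  then have "norm (f (T y)) / nrm E y = norm (f (T (?s \<odot>\<^bsub>E\<^esub> y)))"
    using Ty pos by (simp add: f_smult norm_divide)
  also have "\<dots> \<le> numerical_radius E T"
    by (rule numerical_radius_upper[OF T s f])
  finally have "norm (f (T y)) \<le> numerical_radius E T * nrm E y"
    using pos by (simp add: pos_divide_le_eq)
  then have "norm a * norm (f (T y)) \<le> norm a * (numerical_radius E T * nrm E y)"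
    by (rule mult_left_mono) simp
  then have "(1 - norm a * numerical_radius E T) * nrm E y \<le> norm (f y) - norm (a * f (T y))"
    using pos by (simp add: fy norm_mult algebra_simps)
  also have "\<dots> \<le> norm (f y - a * f (T y))"
    by (rule norm_triangle_ineq2)
  also have "f y - a * f (T y) = f (y \<oplus>\<^bsub>E\<^esub> (- a) \<odot>\<^bsub>E\<^esub> T y)"
    using y Ty by (simp add: f_add f_smult)
  also have "norm \<dots> \<le> nrm E (y \<oplus>\<^bsub>E\<^esub> (- a) \<odot>\<^bsub>E\<^esub> T y)"
    using y Ty by (intro dual_unit_sphere_le[OF f(1)]) auto
  finally show ?thesis .
qed

text \<open>Lumer's estimate: apply the lower bound for \<open>I - a T\<close> to \<open>(I + a T) x\<close>.\<close>

lemma nrm_plus_op_le: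
  assumes T: "T \<in> bounded_ops E E" and M: "opnorm E E T \<le> M" and x: "x \<in> carrier E"
  shows "(1 - norm a * numerical_radius E T) * nrm E (x \<oplus>\<^bsub>E\<^esub> a \<odot>\<^bsub>E\<^esub> T x)
    \<le> (1 + (norm a)\<^sup>2 * M\<^sup>2) * nrm E x"
proof -
  let ?y = "x \<oplus>\<^bsub>E\<^esub> a \<odot>\<^bsub>E\<^esub> T x"
  have Tc: "T z \<in> carrier E" if "z \<in> carrier E" for z
    using T that by (auto simp: bounded_ops_def)
  have T_le: "nrm E (T z) \<le> M * nrm E z" if "z \<in> carrier E" for z
    using nrm_bounded_op_le[OF T that] mult_right_mono[OF M nrm_nonneg[OF that]] by linarith
  have "T ?y = T x \<oplus>\<^bsub>E\<^esub> a \<odot>\<^bsub>E\<^esub> T (T x)"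
    using T x Tc by (simp add: bounded_ops_def)
  \<comment> \<open>This is \<open>(I - a T) (I + a T) = I - a^2 T^2\<close>: the first-order terms
    cancel.\<close>
  then have "?y \<oplus>\<^bsub>E\<^esub> (- a) \<odot>\<^bsub>E\<^esub> T ?y =
      (x \<oplus>\<^bsub>E\<^esub> a \<odot>\<^bsub>E\<^esub> T x) \<oplus>\<^bsub>E\<^esub> ((- a) \<odot>\<^bsub>E\<^esub> T x \<oplus>\<^bsub>E\<^esub> (- (a * a)) \<odot>\<^bsub>E\<^esub> T (T x))"
    using x Tc by (simp add: smult_r_distr smult_smult)
  also have "\<dots> = x \<oplus>\<^bsub>E\<^esub> ((a \<odot>\<^bsub>E\<^esub> T x \<oplus>\<^bsub>E\<^esub> (- a) \<odot>\<^bsub>E\<^esub> T x) \<oplus>\<^bsub>E\<^esub> (- (a * a)) \<odot>\<^bsub>E\<^esub> T (T x))"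
    using x Tc by (simp add: a_assoc)
  also have "a \<odot>\<^bsub>E\<^esub> T x \<oplus>\<^bsub>E\<^esub> (- a) \<odot>\<^bsub>E\<^esub> T x = \<zero>\<^bsub>E\<^esub>"
    using smult_l_distr[of "T x" a "- a"] x Tc by simp
  finally have eq: "?y \<oplus>\<^bsub>E\<^esub> (- a) \<odot>\<^bsub>E\<^esub> T ?y = x \<oplus>\<^bsub>E\<^esub> (- (a * a)) \<odot>\<^bsub>E\<^esub> T (T x)"
    using x Tc by simp
  have "0 \<le> M" using opnorm_nonneg[OF T] M by linarith
  have "(1 - norm a * numerical_radius E T) * nrm E ?y \<le> nrm E (?y \<oplus>\<^bsub>E\<^esub> (- a) \<odot>\<^bsub>E\<^esub> T ?y)"
    using x Tc by (intro nrm_minus_op_ge[OF T]) auto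
  also have "\<dots> \<le> nrm E x + nrm E ((- (a * a)) \<odot>\<^bsub>E\<^esub> T (T x))"
    unfolding eq using x Tc by (intro nrm_triangle) auto
  also have "nrm E ((- (a * a)) \<odot>\<^bsub>E\<^esub> T (T x)) = (norm a)\<^sup>2 * nrm E (T (T x))"
    using x Tc by (simp add: nrm_smult norm_mult power2_eq_square)
  also have "nrm E (T (T x)) \<le> M * (M * nrm E x)"
    using T_le[OF Tc[OF x]] mult_left_mono[OF T_le[OF x] \<open>0 \<le> M\<close>] by linarith
  then have "nrm E x + (norm a)\<^sup>2 * nrm E (T (T x)) \<le> nrm E x + (norm a)\<^sup>2 * (M * (M * nrm E x))"
    by (simp add: mult_left_mono)
  also have "\<dots> = (1 + (norm a)\<^sup>2 * M\<^sup>2) * nrm E x"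
    by (simp add: power2_eq_square algebra_simps)
  finally show ?thesis .
qed

end


subsection \<open>Ultraproducts\<close>

locale banach_ultraproduct =
  fixes E :: "nat \<Rightarrow> ('k::real_or_complex, 'v) normed_space" and U :: "nat filter"
  assumes banach: "\<And>n. banach_space (E n)" and ultrafilter: "free_ultrafilter U"
begin

sublocale B: banach_space "E n" for n
  by (rule banach)

lemma U_nontrivial: "U \<noteq> bot"
  using ultrafilter by (simp add: free_ultrafilter_def)

abbreviation "cls \<equiv> ultraclass U E"

lemma linf_simps:
  "x \<oplus>\<^bsub>linf_space E\<^esub> y = (\<lambda>n. x n \<oplus>\<^bsub>E n\<^esub> y n)"
  "\<zero>\<^bsub>linf_space E\<^esub> = (\<lambda>n. \<zero>\<^bsub>E n\<^esub>)"
  "a \<odot>\<^bsub>linf_space E\<^esub> x = (\<lambda>n. a \<odot>\<^bsub>E n\<^esub> x n)"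
  "nrm (linf_space E) x = (SUP n. nrm (E n) (x n))"
  by (simp_all add: linf_space_def)

section \<open>Bounded sequences as an abelian group\<close>

lemma linf_carrierI:
  "(\<And>n. x n \<in> carrier (E n)) \<Longrightarrow> (\<And>n. nrm (E n) (x n) \<le> C) \<Longrightarrow> x \<in> carrier (linf_space E)"
  by (auto simp: linf_space_def intro!: bdd_aboveI2[of _ _ C])

lemma linf_carrierD: "x \<in> carrier (linf_space E) \<Longrightarrow> x n \<in> carrier (E n)"
  by (simp add: linf_space_def)

lemma linf_bounded:
  assumes "x \<in> carrier (linf_space E)"
  obtains C where "\<And>n. nrm (E n) (x n) \<le> C"
  using assms by (auto simp: linf_space_def bdd_above_def)

lemma linf_smult_closed:
  assumes "x \<in> carrier (linf_space E)"
  shows "(\<lambda>n. a \<odot>\<^bsub>E n\<^esub> x n) \<in> carrier (linf_space E)"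
proof -
  obtain C where "\<And>n. nrm (E n) (x n) \<le> C" using linf_bounded[OF assms] by blast
  then show ?thesis
    using assms
    by (intro linf_carrierI[of _ "norm a * C"])
      (auto simp: linf_carrierD B.nrm_smult intro: mult_left_mono)
qed

lemma linf_add_closed:
  assumes "x \<in> carrier (linf_space E)" "y \<in> carrier (linf_space E)"
  shows "(\<lambda>n. x n \<oplus>\<^bsub>E n\<^esub> y n) \<in> carrier (linf_space E)"
proof -
  obtain C where C: "\<And>n. nrm (E n) (x n) \<le> C" using linf_bounded[OF assms(1)] by blast
  obtain D where D: "\<And>n. nrm (E n) (y n) \<le> D" using linf_bounded[OF assms(2)] by blast
  have "nrm (E n) (x n \<oplus>\<^bsub>E n\<^esub> y n) \<le> C + D" for n
    using B.nrm_triangle[of "x n" n "y n"] assms C[of n] D[of n] by (simp add: linf_carrierD)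
  then show ?thesis
    using assms by (intro linf_carrierI[of _ "C + D"]) (auto simp: linf_carrierD)
qed

lemma linf_neg:
  assumes "x \<in> carrier (linf_space E)"
  shows "(\<lambda>n. \<ominus>\<^bsub>E n\<^esub> x n) \<in> carrier (linf_space E)"
    "(\<lambda>n. \<ominus>\<^bsub>E n\<^esub> x n) \<oplus>\<^bsub>linf_space E\<^esub> x = \<zero>\<^bsub>linf_space E\<^esub>"
proof -
  obtain C where "\<And>n. nrm (E n) (x n) \<le> C" using linf_bounded[OF assms] by blast
  then show "(\<lambda>n. \<ominus>\<^bsub>E n\<^esub> x n) \<in> carrier (linf_space E)"
    using assms by (intro linf_carrierI[of _ C]) (auto simp: linf_carrierD)
  show "(\<lambda>n. \<ominus>\<^bsub>E n\<^esub> x n) \<oplus>\<^bsub>linf_space E\<^esub> x = \<zero>\<^bsub>linf_space E\<^esub>"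
    using assms by (simp add: linf_simps linf_carrierD B.l_neg)
qed

text \<open>The additive group gives access to the calculus of cosets; scalars are treated on
  representatives.\<close>

sublocale linf: abelian_group "linf_space E"
proof (rule abelian_groupI)
  show "\<zero>\<^bsub>linf_space E\<^esub> \<in> carrier (linf_space E)"
    unfolding linf_simps by (rule linf_carrierI[of _ 0]) auto
  show "\<exists>y\<in>carrier (linf_space E). y \<oplus>\<^bsub>linf_space E\<^esub> x = \<zero>\<^bsub>linf_space E\<^esub>"
    if "x \<in> carrier (linf_space E)" for x
    using linf_neg[OF that] by blast
  show "x \<oplus>\<^bsub>linf_space E\<^esub> y = y \<oplus>\<^bsub>linf_space E\<^esub> x"
    if "x \<in> carrier (linf_space E)" "y \<in> carrier (linf_space E)" for x y
    using that by (simp add: linf_simps linf_carrierD B.a_comm)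
qed (simp_all add: linf_simps linf_add_closed linf_carrierD B.a_assoc)

section \<open>Sequences that are null along the ultrafilter\<close>

lemma c0_iff:
  "h \<in> c0_space U E \<longleftrightarrow> h \<in> carrier (linf_space E) \<and> ((\<lambda>n. nrm (E n) (h n)) \<longlongrightarrow> 0) U"
  by (simp add: c0_space_def)

lemma c0I:
  assumes h: "h \<in> carrier (linf_space E)"
    and le: "\<forall>\<^sub>F n in U. nrm (E n) (h n) \<le> b n" and b: "(b \<longlongrightarrow> 0) U"
  shows "h \<in> c0_space U E"
  unfolding c0_iff
proof (intro conjI h tendsto_sandwich[OF _ le tendsto_const b])
  show "\<forall>\<^sub>F n in U. 0 \<le> nrm (E n) (h n)"
    using h by (simp add: linf_carrierD)
qed

sublocale c0: abelian_subgroup "c0_space U E" "linf_space E"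
proof (rule abelian_subgroupI3)
  show "additive_subgroup (c0_space U E) (linf_space E)"
  proof (rule additive_subgroupI, rule linf.add.subgroupI)
    show "c0_space U E \<subseteq> carrier (linf_space E)" by (auto simp: c0_iff)
    have "\<zero>\<^bsub>linf_space E\<^esub> \<in> c0_space U E"
      unfolding c0_iff using linf.zero_closed by (simp add: linf_simps)
    then show "c0_space U E \<noteq> {}" by blast
  next
    fix x assume x: "x \<in> c0_space U E"
    then have "\<ominus>\<^bsub>linf_space E\<^esub> x = (\<lambda>n. \<ominus>\<^bsub>E n\<^esub> x n)"
      by (intro linf.minus_equality linf_neg) (auto simp: c0_iff)
    with x show "\<ominus>\<^bsub>linf_space E\<^esub> x \<in> c0_space U E"
      by (auto simp: c0_iff linf_neg linf_carrierD)
  next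
    fix x y assume xy: "x \<in> c0_space U E" "y \<in> c0_space U E"
    then have "((\<lambda>n. nrm (E n) (x n) + nrm (E n) (y n)) \<longlongrightarrow> 0 + 0) U"
      by (intro tendsto_add) (auto simp: c0_iff)
    with xy show "x \<oplus>\<^bsub>linf_space E\<^esub> y \<in> c0_space U E"
      by (intro c0I[where b = "\<lambda>n. nrm (E n) (x n) + nrm (E n) (y n)"])
        (auto simp: c0_iff linf_simps linf_carrierD linf_add_closed B.nrm_triangle)
  qed
qed (rule linf.abelian_group_axioms)

section \<open>Classes of bounded sequences and their linear operations\<close>

lemma ultraclass_iff:
  "y \<in> cls x \<longleftrightarrow> (\<exists>h\<in>c0_space U E. y = (\<lambda>n. h n \<oplus>\<^bsub>E n\<^esub> x n))"
  by (auto simp: ultraclass_def a_r_coset_def' linf_simps)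

lemma ultraclass_self: "x \<in> carrier (linf_space E) \<Longrightarrow> x \<in> cls x"
  unfolding ultraclass_def by (rule c0.a_rcos_self)

lemma ultraclass_add_c0:
  assumes "h \<in> c0_space U E" "x \<in> carrier (linf_space E)"
  shows "cls (\<lambda>n. h n \<oplus>\<^bsub>E n\<^esub> x n) = cls x"
  unfolding ultraclass_def
  by (rule linf.a_repr_independence[symmetric])
    (use assms ultraclass_iff c0.a_subgroup in \<open>auto simp: ultraclass_def\<close>)

lemma carrier_ultraproduct: "carrier (ultraproduct U E) = cls ` carrier (linf_space E)"
  by (auto simp: ultraproduct_def quotient_space_def A_RCOSETS_def' ultraclass_def)

lemma add_ultraproduct:
  assumes "x \<in> carrier (linf_space E)" "y \<in> carrier (linf_space E)"
  shows "cls x \<oplus>\<^bsub>ultraproduct U E\<^esub> cls y = cls (\<lambda>n. x n \<oplus>\<^bsub>E n\<^esub> y n)"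
  using c0.a_rcos_sum[OF assms]
  by (simp add: ultraproduct_def quotient_space_def ultraclass_def linf_simps)

text \<open>The common form of well-definedness: a map that ignores null perturbations has a
  one-point image on each class. It serves for scalar multiples and for the ultraproduct
  operator.\<close>

lemma the_elem_image_ultraclass:
  assumes "x \<in> carrier (linf_space E)" "\<And>h. h \<in> c0_space U E \<Longrightarrow> \<phi> (\<lambda>n. h n \<oplus>\<^bsub>E n\<^esub> x n) = \<phi> x"
  shows "the_elem (\<phi> ` cls x) = \<phi> x"
proof -
  have "\<phi> ` cls x = {\<phi> x}"
  proof
    show "\<phi> ` cls x \<subseteq> {\<phi> x}" using assms by (auto simp: ultraclass_iff)
    show "{\<phi> x} \<subseteq> \<phi> ` cls x" using ultraclass_self[OF assms(1)] by simp
  qed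
  then show ?thesis by simp
qed

lemma c0_smult:
  assumes "h \<in> c0_space U E"
  shows "(\<lambda>n. a \<odot>\<^bsub>E n\<^esub> h n) \<in> c0_space U E"
proof (rule c0I)
  show "((\<lambda>n. norm a * nrm (E n) (h n)) \<longlongrightarrow> 0) U"
    using assms by (auto simp: c0_iff intro: tendsto_mult_right_zero)
qed (use assms in \<open>auto simp: c0_iff linf_smult_closed linf_carrierD B.nrm_smult\<close>)

lemma smult_ultraproduct:
  assumes x: "x \<in> carrier (linf_space E)"
  shows "a \<odot>\<^bsub>ultraproduct U E\<^esub> cls x = cls (\<lambda>n. a \<odot>\<^bsub>E n\<^esub> x n)"
proof -
  have "a \<odot>\<^bsub>ultraproduct U E\<^esub> cls x = the_elem ((\<lambda>x. cls (\<lambda>n. a \<odot>\<^bsub>E n\<^esub> x n)) ` cls x)"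
    by (simp add: ultraproduct_def quotient_space_def ultraclass_def linf_simps)
  also have "\<dots> = cls (\<lambda>n. a \<odot>\<^bsub>E n\<^esub> x n)"
  proof (rule the_elem_image_ultraclass[OF x])
    fix h assume h: "h \<in> c0_space U E"
    have "(\<lambda>n. a \<odot>\<^bsub>E n\<^esub> (h n \<oplus>\<^bsub>E n\<^esub> x n)) = (\<lambda>n. a \<odot>\<^bsub>E n\<^esub> h n \<oplus>\<^bsub>E n\<^esub> a \<odot>\<^bsub>E n\<^esub> x n)"
      using h x by (auto simp: c0_iff linf_carrierD B.smult_r_distr)
    then show "cls (\<lambda>n. a \<odot>\<^bsub>E n\<^esub> (h n \<oplus>\<^bsub>E n\<^esub> x n)) = cls (\<lambda>n. a \<odot>\<^bsub>E n\<^esub> x n)"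
      using ultraclass_add_c0[OF c0_smult[OF h] linf_smult_closed[OF x]] by simp
  qed
  finally show ?thesis .
qed

section \<open>The quotient norm as a limit along the ultrafilter\<close>

lemma tendsto_nrm_add_c0:
  assumes h: "h \<in> c0_space U E" and x: "x \<in> carrier (linf_space E)"
    and l: "((\<lambda>n. nrm (E n) (x n)) \<longlongrightarrow> l) U"
  shows "((\<lambda>n. nrm (E n) (h n \<oplus>\<^bsub>E n\<^esub> x n)) \<longlongrightarrow> l) U"
proof (rule tendsto_sandwich)
  have hn: "h n \<in> carrier (E n)" for n using h by (simp add: c0_iff linf_carrierD)
  have xn: "x n \<in> carrier (E n)" for n using x by (simp add: linf_carrierD)
  have h0: "((\<lambda>n. nrm (E n) (h n)) \<longlongrightarrow> 0) U" using h by (simp add: c0_iff)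
  show "\<forall>\<^sub>F n in U. nrm (E n) (x n) - nrm (E n) (h n) \<le> nrm (E n) (h n \<oplus>\<^bsub>E n\<^esub> x n)"
    using B.nrm_triangle_rev[OF xn hn] by (simp add: B.a_comm[OF hn xn])
  show "\<forall>\<^sub>F n in U. nrm (E n) (h n \<oplus>\<^bsub>E n\<^esub> x n) \<le> nrm (E n) (h n) + nrm (E n) (x n)"
    by (simp add: hn xn B.nrm_triangle)
  show "((\<lambda>n. nrm (E n) (x n) - nrm (E n) (h n)) \<longlongrightarrow> l) U"
    using tendsto_diff[OF l h0] by simp
  show "((\<lambda>n. nrm (E n) (h n) + nrm (E n) (x n)) \<longlongrightarrow> l) U"
    using tendsto_add[OF h0 l] by simp
qed

text \<open>Null perturbations do not change the limit \<open>l\<close> of the norms, so every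
  representative has sup norm at least \<open>l\<close>; truncated representatives come arbitrarily
  close to \<open>l\<close>.\<close>

lemma tendsto_nrm_ultraclass:
  assumes x: "x \<in> carrier (linf_space E)"
  shows "((\<lambda>n. nrm (E n) (x n)) \<longlongrightarrow> nrm (ultraproduct U E) (cls x)) U"
proof -
  have xn: "x n \<in> carrier (E n)" for n using x by (rule linf_carrierD)
  obtain C where C: "\<And>n. nrm (E n) (x n) \<le> C" using linf_bounded[OF x] by blast
  then have "norm (nrm (E n) (x n)) \<le> C" for n using xn by simp
  then obtain l where l: "((\<lambda>n. nrm (E n) (x n)) \<longlongrightarrow> l) U"
    using ultrafilter_limit_bounded[OF ultrafilter, of "\<lambda>n. nrm (E n) (x n)"] by blast
  \<comment> \<open>Truncation produces zero entries, whose norm must not exceed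
    \<open>l + e\<close>.\<close>
  have "0 \<le> l"
    by (rule tendsto_lowerbound[OF l _ U_nontrivial]) (simp add: xn)
  have nrm: "nrm (ultraproduct U E) (cls x) = (INF y\<in>cls x. SUP n. nrm (E n) (y n))"
    by (simp add: ultraproduct_def quotient_space_def linf_simps)
  have ge: "l \<le> (SUP n. nrm (E n) (y n))" if y: "y \<in> cls x" for y
  proof -
    obtain h where h: "h \<in> c0_space U E" "y = (\<lambda>n. h n \<oplus>\<^bsub>E n\<^esub> x n)"
      using y by (auto simp: ultraclass_iff)
    then have "y \<in> carrier (linf_space E)"
      using x by (auto simp: c0_iff intro: linf_add_closed)
    then have "nrm (E n) (y n) \<le> (SUP n. nrm (E n) (y n))" for n
      by (intro cSUP_upper) (auto simp: linf_space_def)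
    moreover have "((\<lambda>n. nrm (E n) (y n)) \<longlongrightarrow> l) U"
      unfolding h(2) by (rule tendsto_nrm_add_c0[OF h(1) x l])
    ultimately show ?thesis
      by (intro tendsto_upperbound[OF _ _ U_nontrivial]) auto
  qed
  have "(INF y\<in>cls x. SUP n. nrm (E n) (y n)) = l"
  proof (rule antisym)
    show "l \<le> (INF y\<in>cls x. SUP n. nrm (E n) (y n))"
      using ge ultraclass_self[OF x] by (intro cINF_greatest) auto
    show "(INF y\<in>cls x. SUP n. nrm (E n) (y n)) \<le> l"
    proof (rule field_le_epsilon)
      fix e :: real assume "e > 0"
      \<comment> \<open>truncating \<open>x\<close> where its norm exceeds \<open>l + e\<close> gives another representative\<close>
      define h where "h = (\<lambda>n. if nrm (E n) (x n) < l + e then \<zero>\<^bsub>E n\<^esub> else \<ominus>\<^bsub>E n\<^esub> x n)"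
      let ?y = "\<lambda>n. h n \<oplus>\<^bsub>E n\<^esub> x n"
      have "\<forall>\<^sub>F n in U. nrm (E n) (x n) < l + e"
        using l \<open>e > 0\<close> by (intro order_tendstoD) auto
      then have "\<forall>\<^sub>F n in U. nrm (E n) (h n) \<le> 0"
        by eventually_elim (simp add: h_def)
      moreover have "h \<in> carrier (linf_space E)"
        by (rule linf_carrierI[of _ "max 0 C"]) (use C xn in \<open>auto simp: h_def le_max_iff_disj\<close>)
      ultimately have "h \<in> c0_space U E"
        by (intro c0I[where b = "\<lambda>_. 0"]) auto
      then have "?y \<in> cls x" by (auto simp: ultraclass_iff)
      moreover have "bdd_below ((\<lambda>y. SUP n. nrm (E n) (y n)) ` cls x)"
        using ge by (rule bdd_belowI2)
      ultimately have "(INF y\<in>cls x. SUP n. nrm (E n) (y n)) \<le> (SUP n. nrm (E n) (?y n))"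
        by (intro cINF_lower)
      also have "\<dots> \<le> l + e"
        using \<open>0 \<le> l\<close> \<open>e > 0\<close> xn by (intro cSUP_least) (auto simp: h_def B.l_neg)
      finally show "(INF y\<in>cls x. SUP n. nrm (E n) (y n)) \<le> l + e" .
    qed
  qed
  with l nrm show ?thesis by simp
qed

lemma nrm_ultraclass_eq:
  assumes "x \<in> carrier (linf_space E)" "((\<lambda>n. nrm (E n) (x n)) \<longlongrightarrow> l) U"
  shows "nrm (ultraproduct U E) (cls x) = l"
  using tendsto_unique[OF U_nontrivial tendsto_nrm_ultraclass[OF assms(1)] assms(2)] .

text \<open>Nonnegativity and homogeneity of the ultraproduct norm, required by
  \<open>nrm_le_opnorm\<close>, are limits of the same properties in the spaces
  \<open>E n\<close>.\<close>

lemma dual_ultraproduct_le: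
  assumes F: "F \<in> dual_unit_sphere (ultraproduct U E)" and A: "A \<in> carrier (ultraproduct U E)"
  shows "norm (F A) \<le> nrm (ultraproduct U E) A"
proof -
  have "nrm scalar_space (F A) \<le> opnorm (ultraproduct U E) scalar_space F * nrm (ultraproduct U E) A"
  proof (rule nrm_le_opnorm[OF _ A])
    show "F \<in> bounded_ops (ultraproduct U E) scalar_space"
      using F by (simp add: dual_unit_sphere_def)
  next
    fix A assume "A \<in> carrier (ultraproduct U E)"
    then obtain x where x: "x \<in> carrier (linf_space E)" "A = cls x"
      by (auto simp: carrier_ultraproduct)
    note lim = tendsto_nrm_ultraclass[OF x(1)]
    show "0 \<le> nrm (ultraproduct U E) A"
      unfolding x(2) by (rule tendsto_lowerbound[OF lim _ U_nontrivial]) (simp add: x linf_carrierD)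
    fix a
    show "a \<odot>\<^bsub>ultraproduct U E\<^esub> A \<in> carrier (ultraproduct U E)"
      using x by (simp add: smult_ultraproduct carrier_ultraproduct linf_smult_closed)
    have "((\<lambda>n. norm a * nrm (E n) (x n)) \<longlongrightarrow> norm a * nrm (ultraproduct U E) A) U"
      unfolding x(2) by (intro tendsto_intros lim)
    then show "nrm (ultraproduct U E) (a \<odot>\<^bsub>ultraproduct U E\<^esub> A) = norm a * nrm (ultraproduct U E) A"
      unfolding x(2) smult_ultraproduct[OF x(1)]
      by (intro nrm_ultraclass_eq linf_smult_closed x) (simp add: B.nrm_smult linf_carrierD x)
  qed (simp add: norm_mult)
  then show ?thesis
    using F by (simp add: dual_unit_sphere_def)
qed

text \<open>The limit of \<open>f n (x n)\<close> depends only on the class of \<open>x\<close>: by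
  additivity a null perturbation \<open>h\<close> contributes \<open>f n (h n)\<close>, which tends
  to 0 because it is dominated by the norm of \<open>h n\<close>.\<close>

lemma ultralimit_functional_exists:
  assumes add: "\<And>n x y. x \<in> carrier (E n) \<Longrightarrow> y \<in> carrier (E n) \<Longrightarrow> f n (x \<oplus>\<^bsub>E n\<^esub> y) = f n x + f n y"
    and le: "\<And>n x. x \<in> carrier (E n) \<Longrightarrow> norm (f n x :: 'k) \<le> nrm (E n) x"
  obtains F where "\<And>x. x \<in> carrier (linf_space E) \<Longrightarrow> ((\<lambda>n. f n (x n)) \<longlongrightarrow> F (cls x)) U"
proof (rule that)
  fix x assume x: "x \<in> carrier (linf_space E)"
  have xn: "x n \<in> carrier (E n)" for n using x by (rule linf_carrierD)
  obtain C where "\<And>n. nrm (E n) (x n) \<le> C" using linf_bounded[OF x] by blast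
  then have "norm (f n (x n)) \<le> C" for n
    using le[OF xn] order_trans by blast
  then obtain l where l: "((\<lambda>n. f n (x n)) \<longlongrightarrow> l) U"
    using ultrafilter_limit_bounded[OF ultrafilter, of "\<lambda>n. f n (x n)"] by blast
  \<comment> \<open>The representative at which the witness for \<open>F\<close>, given in the last
    step, is evaluated; it may differ from \<open>x\<close> by a null sequence.\<close>
  let ?y = "SOME y. y \<in> cls x"
  have "?y \<in> cls x" using ultraclass_self[OF x] by (rule someI[where P = "\<lambda>y. y \<in> cls x"])
  then obtain h where h: "h \<in> c0_space U E" "?y = (\<lambda>n. h n \<oplus>\<^bsub>E n\<^esub> x n)"
    unfolding ultraclass_iff by blast
  have hn: "h n \<in> carrier (E n)" for n using h by (simp add: c0_iff linf_carrierD)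
  have "((\<lambda>n. f n (h n)) \<longlongrightarrow> 0) U"
    by (rule Lim_null_comparison[of _ "\<lambda>n. nrm (E n) (h n)"]) (use h le hn in \<open>auto simp: c0_iff\<close>)
  then have "((\<lambda>n. f n (h n) + f n (x n)) \<longlongrightarrow> 0 + l) U"
    by (intro tendsto_add l)
  then have "((\<lambda>n. f n (?y n)) \<longlongrightarrow> l) U"
    unfolding h(2) using hn xn by (simp add: add)
  then have "Lim U (\<lambda>n. f n (?y n)) = l"
    by (rule tendsto_Lim[OF U_nontrivial])
  with l show "((\<lambda>n. f n (x n)) \<longlongrightarrow> Lim U (\<lambda>n. f n ((SOME y. y \<in> cls x) n))) U" by simp
qed

end


subsection \<open>The ultraproduct operator\<close>

locale banach_ultraproduct_op = banach_ultraproduct E U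
  for E :: "nat \<Rightarrow> ('k::real_or_complex, 'v) normed_space" and U :: "nat filter" +
  fixes T :: "nat \<Rightarrow> 'v \<Rightarrow> 'v" and M :: real
  assumes bounded_op: "\<And>n. T n \<in> bounded_ops (E n) (E n)"
    and opnorm_le: "\<And>n. opnorm (E n) (E n) (T n) \<le> M"
begin

abbreviation "TU \<equiv> ultraproduct_op U E T"

abbreviation "v \<equiv> \<lambda>n. numerical_radius (E n) (T n)"

section \<open>Uniform bounds and the action of the operator on classes\<close>

lemma M_nonneg: "0 \<le> M"
  using B.opnorm_nonneg[OF bounded_op] opnorm_le order_trans by blast

lemma op_closed: "x \<in> carrier (E n) \<Longrightarrow> T n x \<in> carrier (E n)"
  using bounded_op[of n] by (auto simp: bounded_ops_def)

lemma op_add: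
  "x \<in> carrier (E n) \<Longrightarrow> y \<in> carrier (E n) \<Longrightarrow> T n (x \<oplus>\<^bsub>E n\<^esub> y) = T n x \<oplus>\<^bsub>E n\<^esub> T n y"
  using bounded_op[of n] by (auto simp: bounded_ops_def)

lemma op_le: "x \<in> carrier (E n) \<Longrightarrow> nrm (E n) (T n x) \<le> M * nrm (E n) x"
  by (rule order_trans[OF B.nrm_bounded_op_le[OF bounded_op]])
    (auto intro: mult_right_mono opnorm_le)

lemma linf_op_closed:
  assumes x: "x \<in> carrier (linf_space E)"
  shows "(\<lambda>n. T n (x n)) \<in> carrier (linf_space E)"
proof -
  obtain C where C: "\<And>n. nrm (E n) (x n) \<le> C" using linf_bounded[OF x] by blast
  have "nrm (E n) (T n (x n)) \<le> M * C" for n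
    using op_le[OF linf_carrierD[OF x]] mult_left_mono[OF C M_nonneg] order_trans by blast
  then show ?thesis
    by (intro linf_carrierI[of _ "M * C"]) (auto simp: op_closed linf_carrierD x)
qed

text \<open>The common bound \<open>M\<close> makes the sequence of operators map null sequences to
  null sequences, so the class of the image is independent of the representative.\<close>

lemma ultraproduct_op_ultraclass:
  assumes x: "x \<in> carrier (linf_space E)"
  shows "TU (cls x) = cls (\<lambda>n. T n (x n))"
  unfolding ultraproduct_op_def
proof (rule the_elem_image_ultraclass[OF x])
  fix h assume h: "h \<in> c0_space U E"
  then have hL: "h \<in> carrier (linf_space E)" by (simp add: c0_iff)
  have "(\<lambda>n. T n (h n)) \<in> c0_space U E"
  proof (rule c0I)
    show "((\<lambda>n. M * nrm (E n) (h n)) \<longlongrightarrow> 0) U"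
      using h by (auto simp: c0_iff intro: tendsto_mult_right_zero)
  qed (use hL in \<open>auto simp: linf_op_closed op_le linf_carrierD\<close>)
  then show "cls (\<lambda>n. T n (h n \<oplus>\<^bsub>E n\<^esub> x n)) = cls (\<lambda>n. T n (x n))"
    using ultraclass_add_c0[OF _ linf_op_closed[OF x]] hL x by (simp add: op_add linf_carrierD)
qed

text \<open>\<open>F\<close> may fail to be an ultralimit of functionals. Its linearity and norm
  bound give a lower bound for the norm of \<open>(I + a T) A\<close>, while
  \<open>nrm_plus_op_le\<close> supplies the upper bound in each \<open>E n\<close>.\<close>

lemma numerical_range_ultraproduct_le:
  assumes A: "A \<in> unit_sphere (ultraproduct U E)"
    and F: "F \<in> dual_unit_sphere (ultraproduct U E)" "F A = 1"
    and L: "(v \<longlongrightarrow> L) U"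
  shows "norm (F (TU A)) \<le> L"
proof (rule ccontr)
  let ?X = "ultraproduct U E"
  define r where "r = norm (F (TU A))"
  assume "\<not> norm (F (TU A)) \<le> L"
  then have "L < r" by (simp add: r_def)
  have "0 \<le> L"
    by (rule tendsto_lowerbound[OF L _ U_nontrivial]) (simp add: B.numerical_radius_nonneg bounded_op)
  obtain x where x: "x \<in> carrier (linf_space E)" "A = cls x"
    using A by (auto simp: unit_sphere_def carrier_ultraproduct)
  have nx: "((\<lambda>n. nrm (E n) (x n)) \<longlongrightarrow> 1) U"
    using tendsto_nrm_ultraclass[OF x(1)] A by (simp add: x(2) unit_sphere_def)
  \<comment> \<open>The unimodular factor that rotates \<open>F (TU A)\<close> to its absolute value
    \<open>r\<close>.\<close>
  define \<theta> where "\<theta> = of_real r / F (TU A)"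
  have "r > 0" using \<open>0 \<le> L\<close> \<open>L < r\<close> by linarith
  then have \<theta>: "norm \<theta> = 1" "\<theta> * F (TU A) = of_real r"
    by (auto simp: \<theta>_def r_def norm_divide)
  \<comment> \<open>The condition \<open>\<alpha> * L \<le> 1\<close> keeps the first factor
    nonnegative, so that a lower bound for the norm can be multiplied by it.\<close>
  have key: "(1 - \<alpha> * L) * (1 + \<alpha> * r) \<le> 1 + \<alpha>\<^sup>2 * M\<^sup>2" if \<alpha>: "\<alpha> \<ge> 0" "\<alpha> * L \<le> 1" for \<alpha>
  proof -
    define a where "a = of_real \<alpha> * \<theta>"
    have na: "norm a = \<alpha>" using \<theta> \<alpha> by (simp add: a_def norm_mult)
    define z where "z = (\<lambda>n. x n \<oplus>\<^bsub>E n\<^esub> a \<odot>\<^bsub>E n\<^esub> T n (x n))"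
    have Tx: "(\<lambda>n. a \<odot>\<^bsub>E n\<^esub> T n (x n)) \<in> carrier (linf_space E)"
      by (intro linf_smult_closed linf_op_closed x)
    have z: "z \<in> carrier (linf_space E)"
      unfolding z_def by (intro linf_add_closed x Tx)
    have "cls z = A \<oplus>\<^bsub>?X\<^esub> a \<odot>\<^bsub>?X\<^esub> TU A"
      unfolding z_def x(2)
      by (simp add: ultraproduct_op_ultraclass smult_ultraproduct add_ultraproduct
          linf_op_closed x Tx)
    moreover have "A \<in> carrier ?X" "TU A \<in> carrier ?X" "a \<odot>\<^bsub>?X\<^esub> TU A \<in> carrier ?X"
      by (simp_all add: x carrier_ultraproduct ultraproduct_op_ultraclass smult_ultraproduct
          linf_op_closed Tx)
    ultimately have "F (cls z) = F A + a * F (TU A)"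
      using F(1) by (simp add: dual_unit_sphere_def bounded_ops_def)
    also have "\<dots> = of_real (1 + \<alpha> * r)"
      using \<theta> by (simp add: F(2) a_def mult.assoc)
    finally have "norm (F (cls z)) = 1 + \<alpha> * r"
      using \<alpha> \<open>r > 0\<close> by (simp only: norm_of_real) simp
    then have "1 + \<alpha> * r \<le> nrm ?X (cls z)"
      using dual_ultraproduct_le[OF F(1), of "cls z"] z by (simp add: carrier_ultraproduct)
    then have "(1 - \<alpha> * L) * (1 + \<alpha> * r) \<le> (1 - \<alpha> * L) * nrm ?X (cls z)"
      using \<alpha> by (intro mult_left_mono) auto
    also have "\<dots> \<le> (1 + \<alpha>\<^sup>2 * M\<^sup>2) * 1"
    \<comment> \<open>The estimate in each \<open>E n\<close> passes to the limit; the norms of the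
      \<open>x n\<close> tend to 1 and need not equal 1.\<close>
    proof (rule tendsto_le[OF U_nontrivial])
      show "((\<lambda>n. (1 - \<alpha> * v n) * nrm (E n) (z n)) \<longlongrightarrow> (1 - \<alpha> * L) * nrm ?X (cls z)) U"
        by (intro tendsto_intros L tendsto_nrm_ultraclass z)
      show "((\<lambda>n. (1 + \<alpha>\<^sup>2 * M\<^sup>2) * nrm (E n) (x n)) \<longlongrightarrow> (1 + \<alpha>\<^sup>2 * M\<^sup>2) * 1) U"
        by (intro tendsto_intros nx)
      show "\<forall>\<^sub>F n in U. (1 - \<alpha> * v n) * nrm (E n) (z n) \<le> (1 + \<alpha>\<^sup>2 * M\<^sup>2) * nrm (E n) (x n)"
        using B.nrm_plus_op_le[OF bounded_op opnorm_le linf_carrierD[OF x(1)], of a]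
        by (simp add: na z_def)
    qed
    finally show ?thesis by simp
  qed
  \<comment> \<open>Expanding \<open>key\<close> gives
    \<open>\<alpha> * (r - L) \<le> \<alpha> * (\<alpha> * D)\<close>. The two bounds in the minimum
    ensure \<open>\<alpha> * L \<le> 1\<close> and \<open>\<alpha> * D < r - L\<close>; adding 1
    keeps the denominators positive and makes the second inequality strict.\<close>
  define D where "D = M\<^sup>2 + r * L"
  define \<alpha> where "\<alpha> = min (1 / (L + 1)) ((r - L) / (D + 1))"
  have "D \<ge> 0" using \<open>0 \<le> L\<close> \<open>r > 0\<close> by (simp add: D_def)
  then have "\<alpha> > 0" using \<open>0 \<le> L\<close> \<open>L < r\<close> by (simp add: \<alpha>_def)
  have "\<alpha> * (L + 1) \<le> 1"
    using \<open>0 \<le> L\<close> by (simp add: \<alpha>_def pos_le_divide_eq[symmetric])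
  then have "\<alpha> * L \<le> 1" using \<open>\<alpha> > 0\<close> by (simp add: distrib_left)
  have "\<alpha> * (D + 1) \<le> r - L"
    using \<open>D \<ge> 0\<close> by (simp add: \<alpha>_def pos_le_divide_eq[symmetric])
  then have "\<alpha> * D < r - L" using \<open>\<alpha> > 0\<close> by (simp add: distrib_left)
  have "\<alpha> * (r - L) \<le> \<alpha> * (\<alpha> * D)"
    using key[of \<alpha>] \<open>\<alpha> > 0\<close> \<open>\<alpha> * L \<le> 1\<close> by (simp add: D_def power2_eq_square algebra_simps)
  then have "r - L \<le> \<alpha> * D" using \<open>\<alpha> > 0\<close> by simp
  with \<open>\<alpha> * D < r - L\<close> show False by simp
qed

text \<open>
  Admissible pairs \<open>(x\<^sub>n, f\<^sub>n)\<close> have an ultraproduct \<open>(cls x, F)\<close> with \<open>F\<close> the ultralimit of the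
  functionals. Where no pair exceeds \<open>c\<close> the zero pair is used; this happens on a null set only.
\<close>

lemma less_numerical_range_ultraproduct:
  assumes c: "\<forall>\<^sub>F n in U. c < v n" "0 \<le> c"
  obtains A F where "A \<in> unit_sphere (ultraproduct U E)" "F \<in> dual_unit_sphere (ultraproduct U E)"
    "F A = 1" "c \<le> norm (F (TU A))"
proof -
  let ?X = "ultraproduct U E"
  define P where "P = (\<lambda>n x f. x \<in> unit_sphere (E n) \<and> f \<in> dual_unit_sphere (E n) \<and> f x = 1 \<and>
    c < norm (f (T n x)))"
  \<comment> \<open>Since \<open>c\<close> is nonnegative, a value above \<open>c\<close> is not the
    inserted 0 and comes from an admissible pair.\<close>
  have ex: "\<exists>x f. P n x f" if "c < v n" for n
  proof -
    from that obtain w where "w \<in> insert 0 {norm (f (T n x)) | x f.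
        x \<in> unit_sphere (E n) \<and> f \<in> dual_unit_sphere (E n) \<and> f x = 1}" "c < w"
      unfolding numerical_radius_def by (auto elim!: less_cSupE)
    with c(2) show ?thesis unfolding P_def by auto
  qed
  define G where "G = {n. \<exists>x f. P n x f}"
  have G: "\<forall>\<^sub>F n in U. n \<in> G"
    using c(1) by eventually_elim (simp add: G_def ex)
  have "\<forall>n. \<exists>x f. n \<in> G \<longrightarrow> P n x f"
    by (auto simp: G_def)
  then obtain x0 f0 where P: "\<And>n. n \<in> G \<Longrightarrow> P n (x0 n) (f0 n)"
    by metis
  \<comment> \<open>Additivity and norm bounds are required at every index, and the zero functional
    satisfies them outside \<open>G\<close>.\<close>
  define x where "x = (\<lambda>n. if n \<in> G then x0 n else \<zero>\<^bsub>E n\<^esub>)"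
  define f where "f = (\<lambda>n. if n \<in> G then f0 n else (\<lambda>_. 0))"
  have x: "x \<in> carrier (linf_space E)"
    using P by (intro linf_carrierI[of _ 1]) (auto simp: x_def P_def unit_sphere_def)
  have f_add: "f n (y \<oplus>\<^bsub>E n\<^esub> z) = f n y + f n z"
    if "y \<in> carrier (E n)" "z \<in> carrier (E n)" for n y z
    using P[of n] that by (auto simp: f_def P_def dual_unit_sphere_def bounded_ops_def)
  have f_smult: "f n (a \<odot>\<^bsub>E n\<^esub> y) = a * f n y" if "y \<in> carrier (E n)" for n a y
    using P[of n] that by (auto simp: f_def P_def dual_unit_sphere_def bounded_ops_def)
  have f_le: "norm (f n y) \<le> nrm (E n) y" if "y \<in> carrier (E n)" for n y
    using P[of n] that by (auto simp: f_def P_def B.dual_unit_sphere_le)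
  obtain F where F: "\<And>y. y \<in> carrier (linf_space E) \<Longrightarrow> ((\<lambda>n. f n (y n)) \<longlongrightarrow> F (cls y)) U"
    using ultralimit_functional_exists[of f, OF f_add f_le] by blast
  have F_eq: "F (cls y) = l" if "y \<in> carrier (linf_space E)" "((\<lambda>n. f n (y n)) \<longlongrightarrow> l) U" for y l
    by (rule tendsto_unique[OF U_nontrivial F[OF that(1)] that(2)])
  have "((\<lambda>n. nrm (E n) (x n)) \<longlongrightarrow> 1) U"
    by (rule tendsto_eventually, use G in eventually_elim) (use P in \<open>auto simp: x_def P_def unit_sphere_def\<close>)
  then have A: "cls x \<in> unit_sphere ?X"
    using x by (simp add: unit_sphere_def carrier_ultraproduct nrm_ultraclass_eq)
  have "((\<lambda>n. f n (x n)) \<longlongrightarrow> 1) U"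
    by (rule tendsto_eventually, use G in eventually_elim) (use P in \<open>auto simp: x_def f_def P_def\<close>)
  then have FA: "F (cls x) = 1" by (rule F_eq[OF x])
  have Fdual: "F \<in> dual_unit_sphere ?X"
  proof (rule dual_unit_sphereI[where x = "cls x"])
    fix A B assume "A \<in> carrier ?X" "B \<in> carrier ?X"
    then obtain y z where y: "y \<in> carrier (linf_space E)" "A = cls y"
      and z: "z \<in> carrier (linf_space E)" "B = cls z"
      by (auto simp: carrier_ultraproduct)
    have "((\<lambda>n. f n (y n \<oplus>\<^bsub>E n\<^esub> z n)) \<longlongrightarrow> F A + F B) U"
      using tendsto_add[OF F[OF y(1)] F[OF z(1)]] y z by (simp add: f_add linf_carrierD)
    then show "F (A \<oplus>\<^bsub>?X\<^esub> B) = F A + F B"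
      using y z by (simp add: add_ultraproduct F_eq linf_add_closed)
  next
    fix a A assume "A \<in> carrier ?X"
    then obtain y where y: "y \<in> carrier (linf_space E)" "A = cls y"
      by (auto simp: carrier_ultraproduct)
    have "((\<lambda>n. f n (a \<odot>\<^bsub>E n\<^esub> y n)) \<longlongrightarrow> a * F A) U"
      using tendsto_mult_left[OF F[OF y(1)], of a] y by (simp add: f_smult linf_carrierD)
    then show "F (a \<odot>\<^bsub>?X\<^esub> A) = a * F A"
      using y by (simp add: smult_ultraproduct F_eq linf_smult_closed)
  next
    fix A assume "A \<in> carrier ?X"
    then obtain y where y: "y \<in> carrier (linf_space E)" "A = cls y"
      by (auto simp: carrier_ultraproduct)
    show "norm (F A) \<le> nrm ?X A"
      unfolding y(2)
      by (rule tendsto_le[OF U_nontrivial tendsto_nrm_ultraclass[OF y(1)] tendsto_norm[OF F[OF y(1)]]])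
        (simp add: f_le linf_carrierD y)
  qed (fact A FA)+
  have "((\<lambda>n. norm (f n (T n (x n)))) \<longlongrightarrow> norm (F (TU (cls x)))) U"
    using tendsto_norm[OF F[OF linf_op_closed[OF x]]] x by (simp add: ultraproduct_op_ultraclass)
  \<comment> \<open>The strict inequality becomes a weak one in the limit.\<close>
  moreover have "\<forall>\<^sub>F n in U. c \<le> norm (f n (T n (x n)))"
    using G by eventually_elim (use P in \<open>auto simp: x_def f_def P_def intro: less_imp_le\<close>)
  ultimately have "c \<le> norm (F (TU (cls x)))"
    by (rule tendsto_lowerbound[OF _ _ U_nontrivial])
  with A Fdual FA show thesis by (rule that)
qed

text \<open>A limit \<open>L\<close> exists because all \<open>v n\<close> lie in the compact
  interval from 0 to \<open>M\<close>. It bounds the numerical range of \<open>TU\<close> by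
  \<open>numerical_range_ultraproduct_le\<close>, and values at least \<open>c\<close> are attained
  for every nonnegative \<open>c\<close> below \<open>L\<close>.\<close>

lemma tendsto_numerical_radius: "(v \<longlongrightarrow> numerical_radius (ultraproduct U E) TU) U"
proof -
  let ?S = "insert 0 {norm (F (TU A)) | A F. A \<in> unit_sphere (ultraproduct U E) \<and>
    F \<in> dual_unit_sphere (ultraproduct U E) \<and> F A = 1}"
  have v: "0 \<le> v n" "v n \<le> M" for n
    using B.numerical_radius_nonneg[OF bounded_op]
      order_trans[OF B.numerical_radius_le_opnorm[OF bounded_op] opnorm_le] by auto
  then obtain L where L: "(v \<longlongrightarrow> L) U"
    using ultrafilter_limit_compact[OF ultrafilter compact_Icc, of v 0 M] by auto
  have "0 \<le> L"
    by (rule tendsto_lowerbound[OF L _ U_nontrivial]) (simp add: v)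
  have upper: "w \<le> L" if "w \<in> ?S" for w
    using that \<open>0 \<le> L\<close> numerical_range_ultraproduct_le[OF _ _ _ L] by auto
  have "Sup ?S = L"
  proof (rule antisym)
    show "Sup ?S \<le> L" using upper by (intro cSup_least) auto
    have bdd: "bdd_above ?S" using upper by (rule bdd_aboveI)
    show "L \<le> Sup ?S"
    proof (rule ccontr)
      assume "\<not> L \<le> Sup ?S"
      \<comment> \<open>The gap between \<open>Sup ?S\<close> and \<open>c\<close> contradicts an
        attained value of at least \<open>c\<close>; the inserted 0 makes \<open>c\<close>
        nonnegative.\<close>
      then obtain c where c: "Sup ?S < c" "c < L" using dense[of "Sup ?S" L] by auto
      have "0 \<le> Sup ?S" by (intro cSup_upper bdd) auto
      with c obtain A F where AF: "A \<in> unit_sphere (ultraproduct U E)"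
        "F \<in> dual_unit_sphere (ultraproduct U E)" "F A = 1" "c \<le> norm (F (TU A))"
        using less_numerical_range_ultraproduct[of c] order_tendstoD(1)[OF L c(2)] by auto
      then have "norm (F (TU A)) \<le> Sup ?S"
        by (intro cSup_upper bdd) auto
      with c AF show False by linarith
    qed
  qed
  with L show ?thesis by (simp add: numerical_radius_def)
qed

end

theorem theoremB:
  fixes E :: "nat \<Rightarrow> ('k::real_or_complex, 'v) normed_space"
    and T :: "nat \<Rightarrow> 'v \<Rightarrow> 'v"
    and U :: "nat filter"
  assumes "\<And>n. banach_space (E n)"
    and "free_ultrafilter U"
    and "\<And>n. T n \<in> bounded_ops (E n) (E n)"
    and "bdd_above (range (\<lambda>n. opnorm (E n) (E n) (T n)))"
  shows "((\<lambda>n. numerical_radius (E n) (T n)) \<longlongrightarrow>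
            numerical_radius (ultraproduct U E) (ultraproduct_op U E T)) U"
proof -
  obtain M where "\<And>n. opnorm (E n) (E n) (T n) \<le> M"
    using assms(4) by (auto simp: bdd_above_def)
  with assms interpret banach_ultraproduct_op E U T M
    by (intro banach_ultraproduct_op.intro banach_ultraproduct.intro
        banach_ultraproduct_op_axioms.intro)
  show ?thesis by (rule tendsto_numerical_radius)
qed

end
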